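(* For the Online Joint Replenishment Problem with holding and backlog costs in the special case of a single item (the tree consists only of the root $r$ and one leaf $v$), there exists a deterministic online algorithm running in polynomial time that is 3-competitive: for every instance $I$, the total cost (service costs plus holding costs plus backlog costs) incurred by the algorithm is at most $3\cdot \mathrm{OPT}(I)$, where $\mathrm{OPT}(I)$ is the minimum total cost of any (offline) solution for $I$.
   Context: Online Joint Replenishment Problem (Online JRP) with holding and backlog costs: Let $T$ be a two-level rooted tree with root $r$ and leaves $v_1,\dots,v_n$ (the leaves are items). Each node $u$ has a nonnegative cost $c(u)$ ($c(r)$ is the joint ordering cost, $c(v_i)$ is the item-specific cost). Fixed constants $h\ge 0$ (holding rate) and $b\ge 0$ (backlog rate) are common to all requests. Requests arrive online over (continuous) time; each request is a tuple $\rho=(v_\rho,a_\rho,d_\rho)$ with leaf $v_\rho$, arrival time $a_\rho$ and soft deadline $d_\rho\ge a_\rho$, and asks for one unit of item $v_\rho$. Several requests may arrive at the same time. At time $t$ the algorithm knows only requests with arrival time at most $t$; the number of requests and the time horizon are unknown. A service at time $t$ is a subtree $T'$ of $T$ containing $r$; it costs $\sum_{u\in V(T')}c(u)$ and can satisfy any subset of not-yet-satisfied requests $\rho$ with $v_\rho\in V(T')$ and $a_\rho\le t$. A request satisfied at time $t\in[a_\rho,d_\rho]$ incurs holding cost $h\cdot(d_\rho-t)$; satisfied at time $t>d_\rho$ it incurs backlog cost $b\cdot(t-d_\rho)$. Every request must eventually be satisfied; the goal is to minimize total service cost plus holding cost plus backlog cost. In the single-item case, every service costs $s=c(r)+c(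v)$.
   Formalization: The ratio 3 is claimed only if the backlog rate b is positive or the service cost s is 0, since for b = 0 and s > 0 no online algorithm has a bounded ratio; polynomial time counts unit-cost operations on real numbers. *)

theory Defs
  imports Complex_Main "HOL-Computational_Algebra.Polynomial"
begin

section \<open>The joint replenishment problem with holding and backlog costs\<close>

text \<open>
  The leaves of the two-level tree are the numbers below \<open>num_items\<close>; the root is implicit.
  A subtree containing the root is therefore given by its set of leaves.
\<close>

record jrp =
  num_items :: nat
  root_cost :: real
  leaf_cost :: "nat \<Rightarrow> real"
  holding_rate :: real
  backlog_rate :: real

record request =
  item :: nat
  arrival :: real
  deadline :: real

text \<open>A service names the requests that it satisfies by their positions in the request sequence.\<close>

record service =
  time :: real
  items :: "nat set"
  served :: "nat set"

definition valid_problem :: "jrp \<Rightarrow> bool" where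
  "valid_problem J \<longleftrightarrow>
     root_cost J \<ge> 0 \<and> (\<forall>v<num_items J. leaf_cost J v \<ge> 0) \<and>
     holding_rate J \<ge> 0 \<and> backlog_rate J \<ge> 0"

text \<open>Requests are listed in order of arrival; simultaneous requests are listed in any order.\<close>

definition valid_requests :: "jrp \<Rightarrow> request list \<Rightarrow> bool" where
  "valid_requests J I \<longleftrightarrow>
     (\<forall>\<rho>\<in>set I. item \<rho> < num_items J \<and> arrival \<rho> \<le> deadline \<rho>) \<and> sorted (map arrival I)"

definition feasible :: "jrp \<Rightarrow> request list \<Rightarrow> service list \<Rightarrow> bool" where
  "feasible J I S \<longleftrightarrow>
     (\<forall>\<sigma>\<in>set S. items \<sigma> \<subseteq> {..<num_items J} \<and>
        (\<forall>i\<in>served \<sigma>. i < length I \<and> item (I ! i) \<in> items \<sigma> \<and> arrival (I ! i) \<le> time \<sigma>)) \<and>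
     (\<forall>i<length I. \<exists>!k. k < length S \<and> i \<in> served (S ! k))"

definition service_cost :: "jrp \<Rightarrow> service \<Rightarrow> real" where
  "service_cost J \<sigma> = root_cost J + (\<Sum>v\<in>items \<sigma>. leaf_cost J v)"

definition delay_cost :: "jrp \<Rightarrow> request \<Rightarrow> real \<Rightarrow> real" where
  "delay_cost J \<rho> t =
     (if t \<le> deadline \<rho> then holding_rate J * (deadline \<rho> - t)
      else backlog_rate J * (t - deadline \<rho>))"

definition total_cost :: "jrp \<Rightarrow> request list \<Rightarrow> service list \<Rightarrow> real" where
  "total_cost J I S =
     (\<Sum>\<sigma>\<leftarrow>S. service_cost J \<sigma> + (\<Sum>i\<in>served \<sigma>. delay_cost J (I ! i) (time \<sigma>)))"

definition opt :: "jrp \<Rightarrow> request list \<Rightarrow> real" where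
  "opt J I = Inf {total_cost J I S |S. feasible J I S}"


section \<open>Deterministic online algorithms\<close>

text \<open>
  A deterministic algorithm maps each request sequence to a sequence of services. It is online if
  what it does up to time \<open>\<tau>\<close> depends only on the requests that have arrived by time \<open>\<tau>\<close>.
  Equivalently, when \<open>I\<close> is the sequence of requests known so far, the services in \<open>A I\<close> that lie in
  the future are those that will be carried out if no further request arrives before.
\<close>

definition known :: "real \<Rightarrow> request list \<Rightarrow> request list" where
  "known \<tau> I = filter (\<lambda>\<rho>. arrival \<rho> \<le> \<tau>) I"

definition online_algorithm :: "jrp \<Rightarrow> (request list \<Rightarrow> service list) \<Rightarrow> bool" where
  "online_algorithm J A \<longleftrightarrow>
     (\<forall>I. valid_requests J I \<longrightarrow> feasible J I (A I)) \<and>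
     (\<forall>I I' \<tau>. valid_requests J I \<longrightarrow> valid_requests J I' \<longrightarrow> known \<tau> I = known \<tau> I' \<longrightarrow>
        filter (\<lambda>\<sigma>. time \<sigma> \<le> \<tau>) (A I) = filter (\<lambda>\<sigma>. time \<sigma> \<le> \<tau>) (A I'))"

definition competitive :: "jrp \<Rightarrow> real \<Rightarrow> (request list \<Rightarrow> service list) \<Rightarrow> bool" where
  "competitive J R A \<longleftrightarrow>
     (\<forall>I. valid_requests J I \<longrightarrow> total_cost J I (A I) \<le> R * opt J I)"


section \<open>Polynomial time\<close>

text \<open>
  Costs and times are real numbers, so running time is measured on a real random access machine
  with unit cost: arithmetic and comparison of reals (without rounding) take one step. Separate
  integer registers serve as addresses and counters. Memory is organised in named arrays, and a
  scalar variable is cell \<open>0\<close> of an array. Expressions occur literally in a program, so their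
  evaluation takes a number of elementary operations that does not depend on the input.
\<close>

record state =
  ints :: "string \<Rightarrow> nat \<Rightarrow> nat"
  reals :: "string \<Rightarrow> nat \<Rightarrow> real"

datatype iexp =
    INum nat
  | IGet string iexp
  | IPlus iexp iexp
  | IMinus iexp iexp

datatype rexp =
    RInt iexp
  | RGet string iexp
  | RPlus rexp rexp
  | RMinus rexp rexp
  | RTimes rexp rexp
  | RDivide rexp rexp

datatype bexp =
    ILess iexp iexp
  | RLess rexp rexp
  | BNot bexp
  | BAnd bexp bexp

datatype com =
    Skip
  | ISet string iexp iexp
  | RSet string iexp rexp
  | Seq com com
  | If bexp com com
  | While bexp com

fun ival :: "iexp \<Rightarrow> state \<Rightarrow> nat" where
  "ival (INum n) s = n"
| "ival (IGet x e) s = ints s x (ival e s)"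
| "ival (IPlus e1 e2) s = ival e1 s + ival e2 s"
| "ival (IMinus e1 e2) s = ival e1 s - ival e2 s"

fun rval :: "rexp \<Rightarrow> state \<Rightarrow> real" where
  "rval (RInt e) s = real (ival e s)"
| "rval (RGet x e) s = reals s x (ival e s)"
| "rval (RPlus e1 e2) s = rval e1 s + rval e2 s"
| "rval (RMinus e1 e2) s = rval e1 s - rval e2 s"
| "rval (RTimes e1 e2) s = rval e1 s * rval e2 s"
| "rval (RDivide e1 e2) s = rval e1 s / rval e2 s"

fun bval :: "bexp \<Rightarrow> state \<Rightarrow> bool" where
  "bval (ILess e1 e2) s \<longleftrightarrow> ival e1 s < ival e2 s"
| "bval (RLess e1 e2) s \<longleftrightarrow> rval e1 s < rval e2 s"
| "bval (BNot b) s \<longleftrightarrow> \<not> bval b s"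
| "bval (BAnd b1 b2) s \<longleftrightarrow> bval b1 s \<and> bval b2 s"

definition set_int :: "string \<Rightarrow> nat \<Rightarrow> nat \<Rightarrow> state \<Rightarrow> state" where
  "set_int x i a s = s\<lparr>ints := (ints s)(x := (ints s x)(i := a))\<rparr>"

definition set_real :: "string \<Rightarrow> nat \<Rightarrow> real \<Rightarrow> state \<Rightarrow> state" where
  "set_real x i a s = s\<lparr>reals := (reals s)(x := (reals s x)(i := a))\<rparr>"

text \<open>\<open>run c s t s'\<close>: started in state \<open>s\<close>, program \<open>c\<close> halts after \<open>t\<close> steps in state \<open>s'\<close>.\<close>

inductive run :: "com \<Rightarrow> state \<Rightarrow> nat \<Rightarrow> state \<Rightarrow> bool" where
  Skip: "run Skip s 1 s"
| ISet: "run (ISet x i e) s 1 (set_int x (ival i s) (ival e s) s)"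
| RSet: "run (RSet x i e) s 1 (set_real x (ival i s) (rval e s) s)"
| Seq: "run c1 s t1 s1 \<Longrightarrow> run c2 s1 t2 s2 \<Longrightarrow> run (Seq c1 c2) s (t1 + t2) s2"
| IfTrue: "bval b s \<Longrightarrow> run c1 s t s' \<Longrightarrow> run (If b c1 c2) s (Suc t) s'"
| IfFalse: "\<not> bval b s \<Longrightarrow> run c2 s t s' \<Longrightarrow> run (If b c1 c2) s (Suc t) s'"
| WhileFalse: "\<not> bval b s \<Longrightarrow> run (While b c) s 1 s"
| WhileTrue: "bval b s \<Longrightarrow> run c s t1 s1 \<Longrightarrow> run (While b c) s1 t2 s2 \<Longrightarrow>
    run (While b c) s (Suc (t1 + t2)) s2"

inductive_cases run_SkipE: "run Skip s t s'"
inductive_cases run_ISetE: "run (ISet x i e) s t s'"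
inductive_cases run_RSetE: "run (RSet x i e) s t s'"
inductive_cases run_SeqE: "run (Seq c1 c2) s t s'"
inductive_cases run_IfE: "run (If b c1 c2) s t s'"
inductive_cases run_WhileE: "run (While b c) s t s'"

lemma run_deterministic: "run c s t s' \<Longrightarrow> run c s u s'' \<Longrightarrow> u = t \<and> s'' = s'"
proof (induction arbitrary: u s'' rule: run.induct)
  case (Skip s)
  then show ?case by (rule run_SkipE) simp
next
  case (ISet x i e s)
  then show ?case by (rule run_ISetE) simp
next
  case (RSet x i e s)
  then show ?case by (rule run_RSetE) simp
next
  case (Seq c1 s t1 s1 c2 t2 s2)
  from Seq.prems obtain u1 r1 u2 where r: "run c1 s u1 r1" "run c2 r1 u2 s''" and u: "u = u1 + u2"
    by (rule run_SeqE)
  have 1: "u1 = t1 \<and> r1 = s1" by (rule Seq.IH(1)) (rule r)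
  have "u2 = t2 \<and> s'' = s2" by (rule Seq.IH(2)) (use r 1 in blast)
  with 1 u show ?case by blast
next
  case (IfTrue b s c1 t s' c2)
  from IfTrue.prems show ?case
    by (rule run_IfE) (use IfTrue.IH IfTrue.hyps in blast)+
next
  case (IfFalse b s c2 t s' c1)
  from IfFalse.prems show ?case
    by (rule run_IfE) (use IfFalse.IH IfFalse.hyps in blast)+
next
  case (WhileFalse b s c)
  from WhileFalse.prems show ?case
    by (rule run_WhileE) (use WhileFalse.hyps in simp)+
next
  case (WhileTrue b s c t1 s1 t2 s2)
  from WhileTrue.prems obtain u1 r1 u2
    where r: "run c s u1 r1" "run (While b c) r1 u2 s''" and u: "u = Suc (u1 + u2)"
    by (rule run_WhileE) (use WhileTrue.hyps in blast)+
  have 1: "u1 = t1 \<and> r1 = s1" by (rule WhileTrue.IH(1)) (rule r)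
  have "u2 = t2 \<and> s'' = s2" by (rule WhileTrue.IH(2)) (use r 1 in blast)
  with 1 u show ?case by blast
qed

definition initial_state :: "jrp \<Rightarrow> request list \<Rightarrow> state" where
  "initial_state J I =
     \<lparr>ints = (\<lambda>_ _. 0)
        (''num_items'' := (\<lambda>_. 0)(0 := num_items J),
         ''num_requests'' := (\<lambda>_. 0)(0 := length I),
         ''item'' := (\<lambda>i. if i < length I then item (I ! i) else 0)),
      reals = (\<lambda>_ _. 0)
        (''root_cost'' := (\<lambda>_. 0)(0 := root_cost J),
         ''leaf_cost'' := (\<lambda>v. if v < num_items J then leaf_cost J v else 0),
         ''holding_rate'' := (\<lambda>_. 0)(0 := holding_rate J),
         ''backlog_rate'' := (\<lambda>_. 0)(0 := backlog_rate J),
         ''arrival'' := (\<lambda>i. if i < length I then arrival (I ! i) else 0),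
         ''deadline'' := (\<lambda>i. if i < length I then deadline (I ! i) else 0))\<rparr>"

text \<open>
  Array \<open>included\<close> is the incidence matrix of services and leaves, stored row by row;
  \<open>assigned\<close> maps each request to the service that satisfies it.
\<close>

definition services_of :: "jrp \<Rightarrow> request list \<Rightarrow> state \<Rightarrow> service list" where
  "services_of J I s =
     map (\<lambda>k. \<lparr>time = reals s ''time'' k,
               items = {v. v < num_items J \<and> ints s ''included'' (k * num_items J + v) \<noteq> 0},
               served = {i. i < length I \<and> ints s ''assigned'' i = k}\<rparr>)
       [0..<ints s ''num_services'' 0]"

text \<open>
  One program has to work for all problems in the class \<open>C\<close>. Since prefixes of request sequences
  are request sequences, the bound also applies to each recomputation on the requests known so far.
\<close>

definition polynomial_time :: "jrp set \<Rightarrow> (jrp \<Rightarrow> request list \<Rightarrow> service list) \<Rightarrow> bool" where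
  "polynomial_time C A \<longleftrightarrow>
     (\<exists>P. \<exists>p :: nat poly. \<forall>J\<in>C. \<forall>I. valid_requests J I \<longrightarrow>
        (\<exists>t s. run P (initial_state J I) t s \<and> t \<le> poly p (num_items J + length I) \<and>
               A J I = services_of J I s))"


section \<open>The single-item case\<close>

definition single_item :: "jrp set" where
  "single_item = {J. valid_problem J \<and> num_items J = 1}"

text \<open>
  If services cost something but backlog costs nothing, an offline solution can wait for the end of
  the sequence and pay for one service only, whereas an online algorithm, which has to satisfy each
  request at some finite time, pays arbitrarily often. Hence no competitive ratio is possible:
\<close>

lemma not_competitive_without_backlog_cost:
  assumes J: "J \<in> single_item" and b: "backlog_rate J = 0"
    and s: "root_cost J + leaf_cost J 0 > 0" and A: "online_algorithm J A"
  shows "\<not> competitive J R A"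
proof
  assume comp: "competitive J R A"
  let ?s = "root_cost J + leaf_cost J 0"
  have n: "num_items J = 1" and nn: "root_cost J \<ge> 0" "leaf_cost J 0 \<ge> 0" "holding_rate J \<ge> 0"
    using J by (auto simp: single_item_def valid_problem_def)
  have delay_nn: "delay_cost J \<rho> t \<ge> 0" for \<rho> t
    using nn b by (simp add: delay_cost_def)
  have sc_nn: "service_cost J \<sigma> \<ge> 0" if "items \<sigma> \<subseteq> {..<num_items J}" for \<sigma>
    unfolding service_cost_def using that n nn
    by (intro add_nonneg_nonneg sum_nonneg) auto
  have cost_nn: "total_cost J I S \<ge> 0" if "feasible J I S" for I S
    unfolding total_cost_def using that
    by (intro sum_list_nonneg) (auto simp: feasible_def intro!: add_nonneg_nonneg sum_nonneg delay_nn sc_nn)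
  have count_mono: "length (filter P xs) < length (filter Q xs)"
    if "\<And>x. P x \<Longrightarrow> Q x" "x \<in> set xs" "Q x" "\<not> P x" for P Q :: "service \<Rightarrow> bool" and xs x
  proof -
    have "{i. i < length xs \<and> P (xs ! i)} \<subset> {i. i < length xs \<and> Q (xs ! i)}"
      using that by (auto simp: in_set_conv_nth)
    then show ?thesis by (simp add: length_filter_conv_card psubset_card_mono)
  qed
  have adversary: "\<exists>I \<tau>. valid_requests J I \<and> (\<forall>\<rho>\<in>set I. arrival \<rho> \<le> \<tau> \<and> deadline \<rho> \<le> \<tau>) \<and>
      k \<le> length (filter (\<lambda>\<sigma>. items \<sigma> = {0} \<and> time \<sigma> \<le> \<tau>) (A I))" for k
  proof (induction k)
    case 0
    show ?case by (rule exI[of _ "[]"]) (simp add: valid_requests_def)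
  next
    case (Suc k)
    then obtain I \<tau> where v: "valid_requests J I"
      and le: "\<forall>\<rho>\<in>set I. arrival \<rho> \<le> \<tau> \<and> deadline \<rho> \<le> \<tau>"
      and k: "k \<le> length (filter (\<lambda>\<sigma>. items \<sigma> = {0} \<and> time \<sigma> \<le> \<tau>) (A I))" by blast
    define \<rho> where "\<rho> = \<lparr>item = 0, arrival = \<tau> + 1, deadline = \<tau> + 1\<rparr>"
    define I' where "I' = I @ [\<rho>]"
    have v': "valid_requests J I'"
      using v le n by (force simp: valid_requests_def I'_def \<rho>_def sorted_append)
    have "known \<tau> I = known \<tau> I'"
      by (simp add: known_def I'_def \<rho>_def)
    with A v v' have eq: "filter (\<lambda>\<sigma>. time \<sigma> \<le> \<tau>) (A I) = filter (\<lambda>\<sigma>. time \<sigma> \<le> \<tau>) (A I')"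
      unfolding online_algorithm_def by blast
    have split: "filter (\<lambda>\<sigma>. items \<sigma> = {0} \<and> time \<sigma> \<le> \<tau>) xs =
        filter (\<lambda>\<sigma>. items \<sigma> = {0}) (filter (\<lambda>\<sigma>. time \<sigma> \<le> \<tau>) xs)" for xs :: "service list"
      by (simp add: conj_commute)
    have k': "k \<le> length (filter (\<lambda>\<sigma>. items \<sigma> = {0} \<and> time \<sigma> \<le> \<tau>) (A I'))"
      using k unfolding split eq .
    have f: "feasible J I' (A I')" using A v' by (auto simp: online_algorithm_def)
    moreover have "length I < length I'" by (simp add: I'_def)
    ultimately obtain \<sigma> where \<sigma>: "\<sigma> \<in> set (A I')" "length I \<in> served \<sigma>"
      unfolding feasible_def by (metis nth_mem)
    have \<sigma>': "items \<sigma> = {0}" "\<tau> + 1 \<le> time \<sigma>"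
      using f \<sigma> n by (force simp: feasible_def I'_def \<rho>_def)+
    have "length (filter (\<lambda>\<sigma>. items \<sigma> = {0} \<and> time \<sigma> \<le> \<tau>) (A I')) <
        length (filter (\<lambda>\<sigma>'. items \<sigma>' = {0} \<and> time \<sigma>' \<le> time \<sigma>) (A I'))"
      by (rule count_mono[of _ _ \<sigma>]) (use \<sigma> \<sigma>' in auto)
    with k' have "Suc k \<le> length (filter (\<lambda>\<sigma>'. items \<sigma>' = {0} \<and> time \<sigma>' \<le> time \<sigma>) (A I'))"
      by simp
    moreover have "\<forall>\<rho>\<in>set I'. arrival \<rho> \<le> time \<sigma> \<and> deadline \<rho> \<le> time \<sigma>"
      using le \<sigma>' by (force simp: I'_def \<rho>_def)
    ultimately show ?case using v' by blast
  qed
  define R' where "R' = max R 0"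
  obtain k :: nat where k: "R' < real k" using reals_Archimedean2 by blast
  obtain I \<tau> where v: "valid_requests J I"
    and le: "\<forall>\<rho>\<in>set I. arrival \<rho> \<le> \<tau> \<and> deadline \<rho> \<le> \<tau>"
    and many: "k \<le> length (filter (\<lambda>\<sigma>. items \<sigma> = {0} \<and> time \<sigma> \<le> \<tau>) (A I))"
    using adversary by blast
  let ?S = "[\<lparr>time = \<tau>, items = {0}, served = {..<length I}\<rparr>]"
  have fS: "feasible J I ?S"
    using v le n by (auto simp: feasible_def valid_requests_def)
  have "delay_cost J (I ! i) \<tau> = 0" if "i < length I" for i
    using le that b by (auto simp: delay_cost_def dest!: nth_mem)
  then have cS: "total_cost J I ?S = ?s"
    by (simp add: total_cost_def service_cost_def)
  have "opt J I \<le> ?s"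
    unfolding opt_def cS[symmetric] using fS
    by (intro cInf_lower bdd_belowI[of _ 0]) (auto simp: cost_nn)
  moreover have "0 \<le> opt J I"
    unfolding opt_def using fS by (intro cInf_greatest) (auto simp: cost_nn)
  ultimately have "R * opt J I \<le> R' * ?s"
    unfolding R'_def by (intro mult_mono) auto
  also have "\<dots> < real k * ?s" using k s by simp
  also have "\<dots> \<le> total_cost J I (A I)"
  proof -
    have f: "feasible J I (A I)" using A v by (auto simp: online_algorithm_def)
    have "real (length (filter (\<lambda>\<sigma>. items \<sigma> = {0} \<and> time \<sigma> \<le> \<tau>) xs)) * ?s \<le> total_cost J I xs"
      if "\<forall>\<sigma>\<in>set xs. items \<sigma> \<subseteq> {..<num_items J}" for xs
      using that
    proof (induction xs)
      case (Cons \<sigma> xs)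
      have "(\<Sum>i\<in>served \<sigma>. delay_cost J (I ! i) (time \<sigma>)) \<ge> 0" by (intro sum_nonneg delay_nn)
      moreover have "service_cost J \<sigma> \<ge> 0" using Cons.prems by (intro sc_nn) simp
      moreover have "service_cost J \<sigma> = ?s" if "items \<sigma> = {0}" using that by (simp add: service_cost_def)
      ultimately show ?case using Cons by (auto simp: total_cost_def algebra_simps)
    qed (simp add: total_cost_def)
    from this[of "A I"] have "real (length (filter (\<lambda>\<sigma>. items \<sigma> = {0} \<and> time \<sigma> \<le> \<tau>) (A I))) * ?s
        \<le> total_cost J I (A I)" using f by (simp add: feasible_def)
    moreover have "real k * ?s \<le> real (length (filter (\<lambda>\<sigma>. items \<sigma> = {0} \<and> time \<sigma> \<le> \<tau>) (A I))) * ?s"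
      using many s by (intro mult_right_mono) auto
    ultimately show ?thesis by linarith
  qed
  finally show False using comp v by (force simp: competitive_def)
qed

end

theory Submission
  imports Defs
begin

text \<open>
  Let \<open>s\<close> be the cost of a service. The algorithm places a service at the time \<open>t\<close> when the backlog
  costs of the unserved overdue requests add up to \<open>s\<close>. It satisfies these requests and then, in
  order of deadline, as many further arrived requests as it can with total holding cost at most \<open>s\<close>.
  So each service costs at most \<open>3s\<close> altogether. Requests that have not arrived by \<open>t\<close> have deadlines
  after \<open>t\<close> and do not influence \<open>t\<close>, which makes the algorithm online.

  An offline solution pays at least \<open>s\<close> for each interval between consecutive services: either it
  has a service there, or the requests that were held at the beginning of the interval or overdue at
  its end cost it at least \<open>s\<close> in delay. These sets of requests are disjoint for different intervals.
\<close>

text \<open>The holding budget answers the way in which an offline solution can undercut a rule that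
  only waits for overdue requests: for little holding cost it serves requests due soon after an
  order together with that order. If a service leaves behind an arrived request that is not yet
  overdue, then holding everything up to its deadline would have cost more than \<open>s\<close>.
  This is the alternative payment of a solution that avoids the backlog cost of an interval without
  ordering in it. The schedule is a recursion on the set of all unserved requests, future ones
  included; that it depends on known requests only is proved afterwards. The trigger time is a
  minimum of finitely many quotients, so exact real arithmetic computes it without simulating
  continuous time. With backlog rate \<open>0\<close> and \<open>s > 0\<close> no backlog ever
  triggers a service and no finite ratio exists. The algorithm must still be feasible and online
  there, so only the comparison with offline solutions assumes that the backlog rate is positive or
  \<open>s\<close> is \<open>0\<close>.\<close>

section \<open>Trigger times\<close>

text \<open>
  The time when \<open>\<Sum>r\<in>U. max 0 (t - d r)\<close>, which is the maximum of \<open>\<Sum>r\<in>K. t - d r\<close> over all \<open>K \<subseteq> U\<close>,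
  reaches \<open>c\<close>. A maximal \<open>K\<close> consists of the smallest deadlines.
\<close>

definition trigger :: "real \<Rightarrow> ('a \<Rightarrow> real) \<Rightarrow> 'a set \<Rightarrow> real" where
  "trigger c d U =
     Min ((\<lambda>i. (c + (\<Sum>r | r \<in> U \<and> d r \<le> d i. d r)) / real (card {r\<in>U. d r \<le> d i})) ` U)"

text \<open>A quotient is at most \<open>x\<close> exactly when the sum over its prefix has reached
  \<open>c\<close> by \<open>x\<close>. Dropping negative terms only raises such a sum, and the
  elements due by \<open>x\<close> form a prefix themselves. The conjunct on \<open>d i\<close>
  matters for \<open>c = 0\<close>, which the empty sum would reach at any time.\<close>

lemma trigger_le_iff:
  assumes fin: "finite U" and ne: "U \<noteq> {}" and c: "c \<ge> 0"
  shows "trigger c d U \<le> x \<longleftrightarrow>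
    (\<exists>i\<in>U. d i \<le> x) \<and> c \<le> (\<Sum>r | r \<in> U \<and> d r \<le> x. x - d r)"
proof -
  have cand: "(c + (\<Sum>r | r \<in> U \<and> d r \<le> d i. d r)) / real (card {r\<in>U. d r \<le> d i}) \<le> x \<longleftrightarrow>
      c \<le> (\<Sum>r | r \<in> U \<and> d r \<le> d i. x - d r)" if "i \<in> U" for i
  proof -
    have "card {r\<in>U. d r \<le> d i} > 0"
      using that fin by (auto simp: card_gt_0_iff)
    then show ?thesis
      by (simp add: sum_subtractf divide_le_eq algebra_simps)
  qed
  have "trigger c d U \<le> x \<longleftrightarrow> (\<exists>i\<in>U. c \<le> (\<Sum>r | r \<in> U \<and> d r \<le> d i. x - d r))"
    using fin ne by (auto simp: trigger_def Min_le_iff cand)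
  also have "\<dots> \<longleftrightarrow> (\<exists>i\<in>U. d i \<le> x) \<and> c \<le> (\<Sum>r | r \<in> U \<and> d r \<le> x. x - d r)"
  proof (intro iffI conjI; (elim bexE conjE)?)
    fix i assume i: "i \<in> U" and le: "c \<le> (\<Sum>r | r \<in> U \<and> d r \<le> d i. x - d r)"
    show "\<exists>i\<in>U. d i \<le> x"
    proof (rule ccontr)
      assume "\<not> (\<exists>i\<in>U. d i \<le> x)"
      then have "(\<Sum>r | r \<in> U \<and> d r \<le> d i. x - d r) < (\<Sum>r | r \<in> U \<and> d r \<le> d i. 0)"
        using fin i by (intro sum_strict_mono) auto
      with le c show False by simp
    qed
    have "(\<Sum>r | r \<in> U \<and> d r \<le> d i. x - d r) \<le>
        (\<Sum>r | r \<in> U \<and> d r \<le> d i \<and> d r \<le> x. x - d r)"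
    proof -
      have "(\<Sum>r | r \<in> U \<and> d r \<le> d i. x - d r) \<le>
          (\<Sum>r | r \<in> U \<and> d r \<le> d i. if d r \<le> x then x - d r else 0)"
        by (intro sum_mono) auto
      also have "\<dots> = (\<Sum>r | r \<in> U \<and> d r \<le> d i \<and> d r \<le> x. x - d r)"
        using fin by (intro sum.mono_neutral_cong_right) auto
      finally show ?thesis .
    qed
    also have "\<dots> \<le> (\<Sum>r | r \<in> U \<and> d r \<le> x. x - d r)"
      using fin by (intro sum_mono2) auto
    finally show "c \<le> (\<Sum>r | r \<in> U \<and> d r \<le> x. x - d r)" using le by linarith
  next
    fix i assume i: "i \<in> U" "d i \<le> x" and le: "c \<le> (\<Sum>r | r \<in> U \<and> d r \<le> x. x - d r)"
    let ?V = "{r\<in>U. d r \<le> x}"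
    have V: "finite (d ` ?V)" "d ` ?V \<noteq> {}" using fin i by auto
    obtain k where k: "k \<in> ?V" "Max (d ` ?V) = d k" using Max_in[OF V] by auto
    have "d r \<le> d k" if "r \<in> ?V" for r
      using Max_ge[OF V(1), of "d r"] that unfolding k(2) by auto
    then have "{r\<in>U. d r \<le> d k} = ?V" using k(1) by force
    with le k(1) show "\<exists>i\<in>U. c \<le> (\<Sum>r | r \<in> U \<and> d r \<le> d i. x - d r)"
      by (intro bexI[of _ k]) simp_all
  qed
  finally show ?thesis .
qed

lemma trigger_overdue:
  assumes "finite U" "U \<noteq> {}" "c \<ge> 0"
  shows "\<exists>i\<in>U. d i \<le> trigger c d U"
  using trigger_le_iff[OF assms, of d "trigger c d U"] by simp

text \<open>At the trigger the sum has reached \<open>c\<close>. It cannot have passed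
  \<open>c\<close>, because the elements due by then form a prefix with a quotient of its own, and
  the trigger is at most that quotient.\<close>

lemma sum_overdue_at_trigger:
  assumes fin: "finite U" and ne: "U \<noteq> {}" and c: "c \<ge> 0"
  shows "(\<Sum>r | r \<in> U \<and> d r \<le> trigger c d U. trigger c d U - d r) = c"
proof (rule antisym)
  let ?t = "trigger c d U"
  let ?V = "{r\<in>U. d r \<le> ?t}"
  have V: "finite (d ` ?V)" "d ` ?V \<noteq> {}" using fin trigger_overdue[OF assms, of d] by auto
  obtain k where k: "k \<in> ?V" "Max (d ` ?V) = d k" using Max_in[OF V] by auto
  have "d r \<le> d k" if "r \<in> ?V" for r
    using Max_ge[OF V(1), of "d r"] that unfolding k(2) by auto
  then have eq: "{r\<in>U. d r \<le> d k} = ?V" using k(1) by force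
  have "?t \<le> (c + (\<Sum>r | r \<in> U \<and> d r \<le> d k. d r)) / real (card {r\<in>U. d r \<le> d k})"
    unfolding trigger_def using fin k by (intro Min_le) auto
  moreover have "card ?V > 0" using fin k by (auto simp: card_gt_0_iff)
  ultimately show "(\<Sum>r\<in>?V. ?t - d r) \<le> c"
    unfolding eq by (simp add: sum_subtractf le_divide_eq algebra_simps)
  show "c \<le> (\<Sum>r\<in>?V. ?t - d r)"
    using trigger_le_iff[OF assms, of d ?t] by simp
qed

text \<open>By \<open>trigger_le_iff\<close>, the question whether a trigger is at most some
  \<open>x \<le> \<tau>\<close> involves only deadlines up to \<open>\<tau>\<close>. Two reals that
  agree on all these questions coincide once one of them is at most \<open>\<tau>\<close>.\<close>

lemma trigger_cong_upto:
  assumes U: "finite U" "U \<noteq> {}" and U': "finite U'" and c: "c \<ge> 0"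
    and eq: "{i\<in>U. d i \<le> \<tau>} = {i\<in>U'. d' i \<le> \<tau>}" "\<And>i. i \<in> U \<Longrightarrow> d i \<le> \<tau> \<Longrightarrow> d' i = d i"
    and le: "trigger c d U \<le> \<tau>"
  shows "U' \<noteq> {}" "trigger c d' U' = trigger c d U"
proof -
  show ne: "U' \<noteq> {}" using trigger_overdue[OF U c, of d] eq(1) le by force
  have iff: "trigger c d' U' \<le> x \<longleftrightarrow> trigger c d U \<le> x" if x: "x \<le> \<tau>" for x
  proof -
    have e: "{i\<in>U'. d' i \<le> x} = {i\<in>U. d i \<le> x}" using eq x by force
    have "(\<Sum>r | r \<in> U' \<and> d' r \<le> x. x - d' r) = (\<Sum>r | r \<in> U \<and> d r \<le> x. x - d r)"
      unfolding e using eq(2) x by (intro sum.cong) auto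
    then show ?thesis
      using e by (auto simp: trigger_le_iff U U' ne c)
  qed
  show "trigger c d' U' = trigger c d U"
    by (meson antisym iff le order.refl order.trans)
qed

section \<open>The algorithm\<close>

definition order_cost :: "jrp \<Rightarrow> real" where
  "order_cost J = root_cost J + leaf_cost J 0"

text \<open>
  If the backlog rate is \<open>0\<close>, then the quotient is \<open>0\<close> and the trigger time is the earliest deadline.
\<close>

definition trigger_time :: "jrp \<Rightarrow> request list \<Rightarrow> nat set \<Rightarrow> real" where
  "trigger_time J I U = trigger (order_cost J / backlog_rate J) (\<lambda>i. deadline (I ! i)) U"

definition held_upto :: "request list \<Rightarrow> nat set \<Rightarrow> real \<Rightarrow> nat \<Rightarrow> nat set" where
  "held_upto I U t i =
     {r\<in>U. arrival (I ! r) \<le> t \<and> t < deadline (I ! r) \<and> deadline (I ! r) \<le> deadline (I ! i)}"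

text \<open>Requests with equal deadlines are held together or postponed together.\<close>

definition postponed :: "jrp \<Rightarrow> request list \<Rightarrow> nat set \<Rightarrow> nat set" where
  "postponed J I U = (let t = trigger_time J I U in
     {i\<in>U. t < deadline (I ! i) \<and>
        \<not> (arrival (I ! i) \<le> t \<and>
            (\<Sum>r\<in>held_upto I U t i. holding_rate J * (deadline (I ! r) - t)) \<le> order_cost J)})"

text \<open>The guard holds whenever \<open>U \<noteq> {}\<close> and the costs are nonnegative; it makes the recursion total.\<close>

function schedule :: "jrp \<Rightarrow> request list \<Rightarrow> nat set \<Rightarrow> service list" where
  "schedule J I U =
     (if finite U \<and> postponed J I U \<subset> U
      then \<lparr>time = trigger_time J I U, items = {0}, served = U - postponed J I U\<rparr>
        # schedule J I (postponed J I U)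
      else [])"
  by pat_completeness auto
termination
  by (relation "measure (\<lambda>(J, I, U). card U)") (auto simp: psubset_card_mono)

declare schedule.simps [simp del]

definition algorithm :: "jrp \<Rightarrow> request list \<Rightarrow> service list" where
  "algorithm J I = schedule J I {..<length I}"

lemma postponed_subset: "postponed J I U \<subseteq> U"
  by (auto simp: postponed_def Let_def)

lemma finite_postponed: "finite U \<Longrightarrow> finite (postponed J I U)"
  by (rule finite_subset[OF postponed_subset])

lemma postponedD: "i \<in> postponed J I U \<Longrightarrow> i \<in> U \<and> trigger_time J I U < deadline (I ! i)"
  by (auto simp: postponed_def Let_def)

section \<open>Requests left before each service, and the sets charged to the intervals\<close>

definition unserved :: "jrp \<Rightarrow> request list \<Rightarrow> nat \<Rightarrow> nat set" where
  "unserved J I k = (postponed J I ^^ k) {..<length I}"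

lemma unserved_0 [simp]: "unserved J I 0 = {..<length I}"
  by (simp add: unserved_def)

lemma unserved_Suc: "unserved J I (Suc k) = postponed J I (unserved J I k)"
  by (simp add: unserved_def)

lemma unserved_antimono: "j \<le> k \<Longrightarrow> unserved J I k \<subseteq> unserved J I j"
proof (induction rule: dec_induct)
  case (step k)
  then show ?case using postponed_subset[of J I "unserved J I k"] by (simp add: unserved_Suc)
qed simp

lemma unserved_bounded: "unserved J I k \<subseteq> {..<length I}"
  using unserved_antimono[of 0 k J I] by simp

lemma finite_unserved: "finite (unserved J I k)"
  by (rule finite_subset[OF unserved_bounded]) simp

text \<open>Interval \<open>k\<close> ends at service \<open>k\<close>, counted from
  \<open>0\<close>. The quantifier over \<open>j\<close> makes the held part empty for
  \<open>k = 0\<close>, where no service opens the interval.\<close>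

definition charged :: "jrp \<Rightarrow> request list \<Rightarrow> nat \<Rightarrow> nat set" where
  "charged J I k =
     {i. \<exists>j. k = Suc j \<and> i \<in> unserved J I j - unserved J I k \<and>
        trigger_time J I (unserved J I j) < deadline (I ! i)} \<union>
     {i\<in>unserved J I k. deadline (I ! i) \<le> trigger_time J I (unserved J I k)}"

lemma charged_bounded: "charged J I k \<subseteq> {..<length I}"
  using unserved_bounded[of J I] by (force simp: charged_def)

text \<open>A request charged to the later interval \<open>k = Suc l\<close> is still unserved
  before service \<open>l\<close>, hence before service \<open>j\<close>. So it was charged to
  \<open>j\<close> as overdue and is satisfied by service \<open>j\<close>, which forces
  \<open>l = j\<close>. Then it would have to be held by that very service, although it is overdue
  there.\<close>

lemma charged_disjoint:
  assumes "j < k"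
  shows "charged J I j \<inter> charged J I k = {}"
proof -
  have False if i: "i \<in> charged J I j" "i \<in> charged J I k" for i
  proof -
    obtain l where k: "k = Suc l" "j \<le> l" using assms by (cases k) auto
    have "i \<in> unserved J I l" using i(2) postponed_subset by (auto simp: charged_def k unserved_Suc)
    then have "i \<in> unserved J I j" using unserved_antimono[OF k(2)] by blast
    then have d: "deadline (I ! i) \<le> trigger_time J I (unserved J I j)"
      using i(1) by (auto simp: charged_def)
    then have "i \<notin> unserved J I (Suc j)" by (auto simp: unserved_Suc dest: postponedD)
    with \<open>i \<in> unserved J I l\<close> have "l = j"
      using unserved_antimono[of "Suc j" l J I] k(2) by (cases "l = j") auto
    then show False
      using i(2) d \<open>i \<notin> unserved J I (Suc j)\<close> by (auto simp: charged_def k)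
  qed
  then show ?thesis by blast
qed

section \<open>Progress of the recursion and the backlog budget\<close>

context
  fixes J :: jrp
  assumes J: "J \<in> single_item"
begin

lemma single_item_simps: "num_items J = 1" "order_cost J \<ge> 0" "holding_rate J \<ge> 0" "backlog_rate J \<ge> 0"
  using J by (auto simp: single_item_def valid_problem_def order_cost_def)

lemma service_cost_single: "service_cost J \<lparr>time = t, items = {0}, served = X\<rparr> = order_cost J"
  by (simp add: service_cost_def order_cost_def)

lemma trigger_ratio_nonneg: "order_cost J / backlog_rate J \<ge> 0"
  using single_item_simps by simp

text \<open>Some deadline has been reached at the trigger time, and its request cannot be postponed.
  This discharges the guard of \<open>schedule\<close> and drives
  \<open>schedule_induct\<close>.\<close>

lemma postponed_psubset:
  assumes "finite U" "U \<noteq> {}"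
  shows "postponed J I U \<subset> U"
  using trigger_overdue[OF assms trigger_ratio_nonneg, of "\<lambda>i. deadline (I ! i)"]
    postponed_subset[of J I U] postponedD[of _ J I U]
  by (force simp: trigger_time_def)

lemma schedule_empty [simp]: "schedule J I {} = []"
  by (simp add: schedule.simps)

lemma schedule_step:
  assumes "finite U" "U \<noteq> {}"
  shows "schedule J I U = \<lparr>time = trigger_time J I U, items = {0}, served = U - postponed J I U\<rparr>
    # schedule J I (postponed J I U)"
  using assms postponed_psubset[OF assms] by (subst schedule.simps) simp

lemma schedule_induct [consumes 1, case_names empty step]:
  assumes "finite U" and "P {}"
    and "\<And>U. finite U \<Longrightarrow> U \<noteq> {} \<Longrightarrow> P (postponed J I U) \<Longrightarrow> P U"
  shows "P U"
  using assms(1)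
proof (induction rule: finite_psubset_induct)
  case (psubset U)
  show ?case
  proof (cases "U = {}")
    case False
    then show ?thesis using psubset.IH[OF postponed_psubset] psubset.hyps assms(3) by blast
  qed (use assms(2) in simp)
qed

lemma overdue_cost_le:
  assumes "finite U" "U \<noteq> {}"
  shows "(\<Sum>r | r \<in> U \<and> deadline (I ! r) \<le> trigger_time J I U.
      backlog_rate J * (trigger_time J I U - deadline (I ! r))) \<le> order_cost J"
  using sum_overdue_at_trigger[OF assms trigger_ratio_nonneg, of "\<lambda>i. deadline (I ! i)"] single_item_simps
  by (cases "backlog_rate J = 0") (auto simp flip: sum_distrib_left trigger_time_def)

text \<open>With backlog rate \<open>0\<close> the left side vanishes. The upper bound
  \<open>overdue_cost_le\<close> survives this, but equality then requires order cost
  \<open>0\<close>. Only the lower bound for offline solutions uses the equality.\<close>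

lemma overdue_cost_eq:
  assumes "finite U" "U \<noteq> {}" and "backlog_rate J > 0 \<or> order_cost J = 0"
  shows "(\<Sum>r | r \<in> U \<and> deadline (I ! r) \<le> trigger_time J I U.
      backlog_rate J * (trigger_time J I U - deadline (I ! r))) = order_cost J"
  using sum_overdue_at_trigger[OF assms(1,2) trigger_ratio_nonneg, of "\<lambda>i. deadline (I ! i)"] assms(3)
  by (auto simp flip: sum_distrib_left trigger_time_def)

lemma delay_cost_nonneg: "delay_cost J \<rho> t \<ge> 0"
  using single_item_simps by (simp add: delay_cost_def)

subsection \<open>Feasibility and cost\<close>

text \<open>Every postponed request is due after the current trigger, so the next trigger cannot be
  earlier. Hence a first trigger beyond \<open>\<tau>\<close> rules out all services up to
  \<open>\<tau>\<close>.\<close>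

lemma time_schedule:
  assumes "finite U" "\<sigma> \<in> set (schedule J I U)"
  shows "trigger_time J I U \<le> time \<sigma>"
  using assms
proof (induction U rule: schedule_induct[where I = I])
  case (step U)
  let ?V = "postponed J I U"
  have "trigger_time J I U \<le> trigger_time J I ?V" if "?V \<noteq> {}"
  proof -
    have "finite ?V" using step(1) by (rule finite_postponed)
    from trigger_overdue[OF this that trigger_ratio_nonneg, of "\<lambda>i. deadline (I ! i)"]
    show ?thesis using postponedD[of _ J I U] by (force simp: trigger_time_def[of J I ?V])
  qed
  then show ?case using step by (cases "?V = {}") (auto simp: schedule_step)
qed simp

lemma served_schedule:
  assumes "finite U"
  shows "(\<Union>\<sigma>\<in>set (schedule J I U). served \<sigma>) = U"
  using assms
proof (induction U rule: schedule_induct[where I = I])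
  case (step U)
  then show ?case using postponed_subset[of J I U] by (auto simp: schedule_step)
qed simp

lemma served_schedule_unique:
  assumes "finite U" "i \<in> U"
  shows "\<exists>!k. k < length (schedule J I U) \<and> i \<in> served (schedule J I U ! k)"
  using assms
proof (induction U rule: schedule_induct[where I = I])
  case (step U)
  let ?V = "postponed J I U"
  have fin: "finite ?V" using step(1) by (rule finite_postponed)
  have eq: "schedule J I U = \<lparr>time = trigger_time J I U, items = {0}, served = U - ?V\<rparr> # schedule J I ?V"
    using step by (simp add: schedule_step)
  show ?case
  proof (cases "i \<in> ?V")
    case True
    obtain k where k: "k < length (schedule J I ?V) \<and> i \<in> served (schedule J I ?V ! k)"
      and uniq: "\<And>l. l < length (schedule J I ?V) \<and> i \<in> served (schedule J I ?V ! l) \<Longrightarrow> l = k"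
      using step(3)[OF True] by blast
    show ?thesis
    proof (rule ex1I[of _ "Suc k"])
      fix l assume "l < length (schedule J I U) \<and> i \<in> served (schedule J I U ! l)"
      with True uniq[of "l - 1"] show "l = Suc k" by (cases l) (auto simp: eq)
    qed (use k in \<open>simp add: eq\<close>)
  next
    case False
    have "i \<notin> served (schedule J I ?V ! l)" if "l < length (schedule J I ?V)" for l
      using False served_schedule[OF fin, of I] that by (auto dest: nth_mem)
    with False step(4) show ?thesis
      by (intro ex1I[of _ 0]) (auto simp: eq nth_Cons split: nat.splits)
  qed
qed simp

lemma feasible_schedule_service:
  assumes "finite U" "\<sigma> \<in> set (schedule J I U)" "\<forall>i\<in>U. arrival (I ! i) \<le> deadline (I ! i)"
  shows "items \<sigma> = {0} \<and> (\<forall>i\<in>served \<sigma>. i \<in> U \<and> arrival (I ! i) \<le> time \<sigma>)"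
  using assms
proof (induction U rule: schedule_induct[where I = I])
  case (step U)
  \<comment> \<open>A request due by the trigger time has arrived, since arrival precedes deadline;
    any other served request passed the arrival test in \<open>postponed\<close>.\<close>
  have *: "arrival (I ! i) \<le> trigger_time J I U" if "i \<in> U - postponed J I U" for i
    using that step(5) by (force simp: postponed_def Let_def)
  show ?case
  proof (cases "\<sigma> \<in> set (schedule J I (postponed J I U))")
    case True
    then show ?thesis using step(3,5) postponed_subset[of J I U] by blast
  next
    case False
    then show ?thesis using step * by (auto simp: schedule_step)
  qed
qed simp

lemma feasible_algorithm:
  assumes v: "valid_requests J I"
  shows "feasible J I (algorithm J I)"
proof -
  have "item (I ! i) = 0 \<and> arrival (I ! i) \<le> deadline (I ! i)" if "i < length I" for i
    using that v single_item_simps by (auto simp: valid_requests_def dest!: nth_mem)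
  then show ?thesis
    using served_schedule_unique[of "{..<length I}" _ I] feasible_schedule_service[of "{..<length I}" _ I]
    by (auto simp: feasible_def algorithm_def single_item_simps)
qed

lemma total_cost_schedule:
  assumes "finite U"
  shows "total_cost J I (schedule J I U) \<le> 3 * order_cost J * real (length (schedule J I U))"
  using assms
proof (induction U rule: schedule_induct[where I = I])
  case (step U)
  let ?t = "trigger_time J I U" and ?G = "U - postponed J I U"
  let ?B = "{i\<in>U. deadline (I ! i) \<le> ?t}" and ?H = "{i\<in>?G. ?t < deadline (I ! i)}"
  have fin: "finite ?B" "finite ?H" using step by auto
  have "?G = ?B \<union> ?H" using postponedD[of _ J I U] by force
  then have "(\<Sum>i\<in>?G. delay_cost J (I ! i) ?t) = (\<Sum>i\<in>?B \<union> ?H. delay_cost J (I ! i) ?t)"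
    by (rule arg_cong)
  also have "\<dots> = (\<Sum>i\<in>?B. delay_cost J (I ! i) ?t) + (\<Sum>i\<in>?H. delay_cost J (I ! i) ?t)"
    using fin by (intro sum.union_disjoint) auto
  finally have "(\<Sum>i\<in>?G. delay_cost J (I ! i) ?t) =
      (\<Sum>i\<in>?B. delay_cost J (I ! i) ?t) + (\<Sum>i\<in>?H. delay_cost J (I ! i) ?t)" .
  moreover have "(\<Sum>i\<in>?B. delay_cost J (I ! i) ?t) =
      (\<Sum>i\<in>?B. backlog_rate J * (?t - deadline (I ! i)))"
    by (intro sum.cong) (auto simp: delay_cost_def)
  moreover have "\<dots> \<le> order_cost J" using step by (intro overdue_cost_le)
  moreover have "(\<Sum>i\<in>?H. delay_cost J (I ! i) ?t) \<le> order_cost J"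
  proof (cases "?H = {}")
    case False
    let ?d = "\<lambda>i. deadline (I ! i)"
    \<comment> \<open>The budget test for the last held deadline covers all of \<open>?H\<close>,
      which is contained in \<open>held_upto\<close> for \<open>q\<close>.\<close>
    obtain q where q: "q \<in> ?H" "\<And>r. r \<in> ?H \<Longrightarrow> ?d r \<le> ?d q"
      using finite_has_maximal[of "?d ` ?H"] fin False by (auto, metis (lifting) linorder_le_cases)
    have "(\<Sum>i\<in>?H. delay_cost J (I ! i) ?t) = (\<Sum>i\<in>?H. holding_rate J * (?d i - ?t))"
      by (intro sum.cong) (auto simp: delay_cost_def)
    also have "\<dots> \<le> (\<Sum>i\<in>held_upto I U ?t q. holding_rate J * (?d i - ?t))"
    proof (intro sum_mono2)
      show "?H \<subseteq> held_upto I U ?t q"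
        using q(2) by (auto simp: held_upto_def postponed_def Let_def)
    qed (use step single_item_simps in \<open>auto simp: held_upto_def\<close>)
    also have "\<dots> \<le> order_cost J"
      using q(1) by (auto simp: postponed_def Let_def)
    finally show ?thesis .
  next
    case True
    then show ?thesis using single_item_simps by (simp only: sum.empty)
  qed
  ultimately have "(\<Sum>i\<in>?G. delay_cost J (I ! i) ?t) \<le> 2 * order_cost J" by linarith
  then show ?case
    using step by (simp add: schedule_step total_cost_def service_cost_single algebra_simps)
qed (simp add: total_cost_def)

subsection \<open>The decisions up to time \<open>\<tau>\<close>\<close>

text \<open>\<open>U'\<close> is generalised because after a common service the leftover sets agree
  only on requests arriving by \<open>\<tau>\<close>. If one first trigger is at most
  \<open>\<tau>\<close>, the other equals it, and the choice of served requests depends only on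
  those that have arrived by then.\<close>

lemma schedule_eq_upto:
  assumes "finite U" "finite U'"
    and "\<forall>i\<in>U. arrival (I ! i) \<le> deadline (I ! i)" "\<forall>i\<in>U'. arrival (I' ! i) \<le> deadline (I' ! i)"
    and "{i\<in>U. arrival (I ! i) \<le> \<tau>} = {i\<in>U'. arrival (I' ! i) \<le> \<tau>}"
    and "\<forall>i\<in>U. arrival (I ! i) \<le> \<tau> \<longrightarrow> I' ! i = I ! i"
  shows "filter (\<lambda>\<sigma>. time \<sigma> \<le> \<tau>) (schedule J I U) = filter (\<lambda>\<sigma>. time \<sigma> \<le> \<tau>) (schedule J I' U')"
  using assms
proof (induction U arbitrary: U' rule: schedule_induct[where I = I])
  have late: "filter (\<lambda>\<sigma>. time \<sigma> \<le> \<tau>) (schedule J I U) = []"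
    if "finite U" "U \<noteq> {} \<longrightarrow> \<tau> < trigger_time J I U" for I U
    using that time_schedule[of U _ I] by (cases "U = {}") (force simp: filter_empty_conv)+
  have next_eq: "U' \<noteq> {} \<and> trigger_time J I' U' = trigger_time J I U"
    if "finite U" "U \<noteq> {}" "finite U'" "trigger_time J I U \<le> \<tau>"
      "\<forall>i\<in>U. arrival (I ! i) \<le> deadline (I ! i)" "\<forall>i\<in>U'. arrival (I' ! i) \<le> deadline (I' ! i)"
      "{i\<in>U. arrival (I ! i) \<le> \<tau>} = {i\<in>U'. arrival (I' ! i) \<le> \<tau>}"
      "\<forall>i\<in>U. arrival (I ! i) \<le> \<tau> \<longrightarrow> I' ! i = I ! i" for U U' I I'
  proof -
    have "{i\<in>U. deadline (I ! i) \<le> \<tau>} = {i\<in>U'. deadline (I' ! i) \<le> \<tau>}"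
    proof (intro set_eqI)
      fix i
      have "i \<in> U \<and> arrival (I ! i) \<le> \<tau> \<longleftrightarrow> i \<in> U' \<and> arrival (I' ! i) \<le> \<tau>"
        using that(7) by (simp add: set_eq_iff)
      then show "i \<in> {i\<in>U. deadline (I ! i) \<le> \<tau>} \<longleftrightarrow> i \<in> {i\<in>U'. deadline (I' ! i) \<le> \<tau>}"
        using that(5,6,8) order.trans by (smt (verit) mem_Collect_eq)
    qed
    moreover have "deadline (I' ! i) = deadline (I ! i)" if "i \<in> U" "deadline (I ! i) \<le> \<tau>" for i
      using \<open>\<forall>i\<in>U. arrival (I ! i) \<le> deadline (I ! i)\<close> that
        \<open>\<forall>i\<in>U. arrival (I ! i) \<le> \<tau> \<longrightarrow> I' ! i = I ! i\<close> by force
    ultimately show ?thesis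
      using trigger_cong_upto[OF that(1,2,3) trigger_ratio_nonneg, of "\<lambda>i. deadline (I ! i)" \<tau> "\<lambda>i. deadline (I' ! i)"]
        that(4) unfolding trigger_time_def by blast
  qed
  {
    case empty
    \<comment> \<open>\<open>U'\<close> may still contain requests, but all of them arrive after
      \<open>\<tau>\<close>.\<close>
    have "U' \<noteq> {} \<longrightarrow> \<tau> < trigger_time J I' U'"
      using next_eq[of U' "{}" I' I] empty by force
    then have "filter (\<lambda>\<sigma>. time \<sigma> \<le> \<tau>) (schedule J I' U') = []"
      using empty by (intro late) auto
    then show ?case by simp
  next
    case (step U)
    show ?case
    proof (cases "trigger_time J I U \<le> \<tau>")
      case False
      have "U' \<noteq> {} \<longrightarrow> \<tau> < trigger_time J I' U'"
      proof (intro impI, rule ccontr)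
        assume that: "U' \<noteq> {}" and "\<not> \<tau> < trigger_time J I' U'"
        then have le: "trigger_time J I' U' \<le> \<tau>" by simp
        have "\<forall>i\<in>U'. arrival (I' ! i) \<le> \<tau> \<longrightarrow> I ! i = I' ! i"
          using step.prems(4,5) by force
        from next_eq[of U' U I' I, OF step.prems(1) that step.hyps(1) le step.prems(3,2) step.prems(4)[symmetric] this]
        show False using False le by simp
      qed
      then have "filter (\<lambda>\<sigma>. time \<sigma> \<le> \<tau>) (schedule J I' U') = []"
        using step.prems by (intro late) auto
      moreover have "filter (\<lambda>\<sigma>. time \<sigma> \<le> \<tau>) (schedule J I U) = []"
        using step.hyps False by (intro late) auto
      ultimately show ?thesis by simp
    next
      case True
      let ?t = "trigger_time J I U"
      have ne': "U' \<noteq> {}" and t': "trigger_time J I' U' = ?t"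
        using next_eq[of U U' I I'] step True by auto
      have early: "i \<in> U \<and> arrival (I ! i) \<le> x \<longleftrightarrow> i \<in> U' \<and> arrival (I' ! i) \<le> x" if "x \<le> \<tau>" for i x
        using step.prems(4,5) that by (auto simp: set_eq_iff) (metis order.trans)+
      have same: "I' ! i = I ! i" if "i \<in> U" "arrival (I ! i) \<le> ?t" for i
        using that step.prems(5) True by force
      have held: "held_upto I' U' ?t i = held_upto I U ?t i" if "i \<in> U" "arrival (I ! i) \<le> ?t" for i
      proof (intro set_eqI)
        fix r
        show "r \<in> held_upto I' U' ?t i \<longleftrightarrow> r \<in> held_upto I U ?t i"
          using early[OF True, of r] same[of r] same[OF that] unfolding held_upto_def by auto
      qed
      have G: "U' - postponed J I' U' = U - postponed J I U"
      proof (intro set_eqI)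
        fix i
        have *: "(\<Sum>r\<in>held_upto I' U' ?t i. holding_rate J * (deadline (I' ! r) - ?t)) =
            (\<Sum>r\<in>held_upto I U ?t i. holding_rate J * (deadline (I ! r) - ?t))"
          if "i \<in> U" "arrival (I ! i) \<le> ?t"
          unfolding held[OF that] by (intro sum.cong) (auto simp: held_upto_def same)
        \<comment> \<open>Being served forces arrival by \<open>?t\<close>, also for overdue
          requests, so the criterion reads only requests on which both inputs agree. It is stated
          for arbitrary \<open>V\<close> and \<open>K\<close> to serve both sides.\<close>
        have "i \<in> V - postponed J K V \<longleftrightarrow> (i \<in> V \<and> arrival (K ! i) \<le> ?t) \<and>
            (deadline (K ! i) \<le> ?t \<or>
             (\<Sum>r\<in>held_upto K V ?t i. holding_rate J * (deadline (K ! r) - ?t)) \<le> order_cost J)"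
          if "trigger_time J K V = ?t" "\<forall>i\<in>V. arrival (K ! i) \<le> deadline (K ! i)" for V K
          using that by (force simp: postponed_def Let_def)
        from this[OF t' step.prems(3)] this[OF refl step.prems(2)]
        show "i \<in> U' - postponed J I' U' \<longleftrightarrow> i \<in> U - postponed J I U"
          using early[OF True, of i] same[of i] * by auto
      qed
      have P: "i \<in> postponed J I U \<and> arrival (I ! i) \<le> \<tau> \<longleftrightarrow> i \<in> postponed J I' U' \<and> arrival (I' ! i) \<le> \<tau>" for i
        using G early[of \<tau> i] postponed_subset[of J I U] postponed_subset[of J I' U'] by blast
      have "filter (\<lambda>\<sigma>. time \<sigma> \<le> \<tau>) (schedule J I (postponed J I U)) =
          filter (\<lambda>\<sigma>. time \<sigma> \<le> \<tau>) (schedule J I' (postponed J I' U'))"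
        using step.prems postponed_subset[of J I U] postponed_subset[of J I' U'] P
        by (intro step.IH finite_postponed) blast+
      then show ?thesis using step ne' t' G by (simp add: schedule_step)
    qed
  }
qed

text \<open>Sorting by arrival makes \<open>known \<tau> I\<close> a prefix of \<open>I\<close>, so
  a request known at \<open>\<tau>\<close> has the same position in both lists.\<close>

lemma nth_known:
  assumes "sorted (map arrival I)" "known \<tau> I = known \<tau> I'" "sorted (map arrival I')"
  shows "{i\<in>{..<length I}. arrival (I ! i) \<le> \<tau>} = {i\<in>{..<length I'}. arrival (I' ! i) \<le> \<tau>}"
    and "\<forall>i<length I. arrival (I ! i) \<le> \<tau> \<longrightarrow> I' ! i = I ! i"
proof -
  have *: "(i < length I \<and> arrival (I ! i) \<le> \<tau> \<longleftrightarrow> i < length (known \<tau> I)) \<and>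
      (i < length (known \<tau> I) \<longrightarrow> known \<tau> I ! i = I ! i)"
    if "sorted (map arrival I)" for I i
    using that
  proof (induction I arbitrary: i)
    case (Cons \<rho> I)
    show ?case
    proof (cases "arrival \<rho> \<le> \<tau>")
      case True
      then show ?thesis using Cons by (cases i) (auto simp: known_def)
    next
      case False
      then have "\<forall>\<rho>'\<in>set (\<rho> # I). \<not> arrival \<rho>' \<le> \<tau>" using Cons.prems by force
      then have "known \<tau> (\<rho> # I) = []" by (simp add: known_def filter_empty_conv)
      moreover have "\<not> arrival ((\<rho> # I) ! i) \<le> \<tau>" if "i < length (\<rho> # I)"
        using \<open>\<forall>\<rho>'\<in>set (\<rho> # I). \<not> arrival \<rho>' \<le> \<tau>\<close> nth_mem[OF that] by blast
      ultimately show ?thesis by auto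
    qed
  qed (simp add: known_def)
  show "{i\<in>{..<length I}. arrival (I ! i) \<le> \<tau>} = {i\<in>{..<length I'}. arrival (I' ! i) \<le> \<tau>}"
    using *[OF assms(1)] *[OF assms(3)] assms(2) by auto
  show "\<forall>i<length I. arrival (I ! i) \<le> \<tau> \<longrightarrow> I' ! i = I ! i"
    using *[OF assms(1)] *[OF assms(3)] assms(2) by metis
qed

lemma online_algorithm_algorithm: "online_algorithm J (algorithm J)"
  unfolding online_algorithm_def
proof (intro conjI allI impI)
  fix I assume "valid_requests J I"
  then show "feasible J I (algorithm J I)" by (rule feasible_algorithm)
next
  fix I I' \<tau> assume v: "valid_requests J I" "valid_requests J I'" and k: "known \<tau> I = known \<tau> I'"
  have *: "sorted (map arrival I)" "sorted (map arrival I')"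
    "\<forall>i\<in>{..<length I}. arrival (I ! i) \<le> deadline (I ! i)"
    "\<forall>i\<in>{..<length I'}. arrival (I' ! i) \<le> deadline (I' ! i)"
    using v by (auto simp: valid_requests_def)
  show "filter (\<lambda>\<sigma>. time \<sigma> \<le> \<tau>) (algorithm J I) = filter (\<lambda>\<sigma>. time \<sigma> \<le> \<tau>) (algorithm J I')"
    unfolding algorithm_def
    using * nth_known[OF *(1) k *(2)] by (intro schedule_eq_upto) auto
qed

subsection \<open>Comparison with offline solutions\<close>

lemma schedule_nth:
  assumes "finite U" "k < length (schedule J I U)"
  shows "(postponed J I ^^ k) U \<noteq> {} \<and>
    schedule J I U ! k = \<lparr>time = trigger_time J I ((postponed J I ^^ k) U), items = {0},
      served = (postponed J I ^^ k) U - (postponed J I ^^ Suc k) U\<rparr>"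
  using assms
proof (induction U arbitrary: k rule: schedule_induct[where I = I])
  case (step U)
  then show ?case by (cases k) (auto simp: schedule_step funpow_swap1)
qed (simp add: schedule_empty)

lemma postponed_funpow_length:
  assumes "finite U"
  shows "(postponed J I ^^ length (schedule J I U)) U = {}"
  using assms
proof (induction U rule: schedule_induct[where I = I])
  case (step U)
  then show ?case by (simp add: schedule_step funpow_swap1)
qed (simp add: schedule_empty)

lemma length_schedule_le:
  assumes "finite U"
  shows "length (schedule J I U) \<le> card U"
  using assms
proof (induction U rule: schedule_induct[where I = I])
  case (step U)
  then show ?case
    using psubset_card_mono[OF step(1) postponed_psubset[OF step(1,2), of I]]
    by (simp add: schedule_step)
qed (simp add: schedule_empty)

lemma unserved_nonempty: "k < length (algorithm J I) \<Longrightarrow> unserved J I k \<noteq> {}"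
  using schedule_nth[of "{..<length I}" k I] by (simp add: algorithm_def unserved_def)

lemma unserved_length: "unserved J I (length (algorithm J I)) = {}"
  using postponed_funpow_length[of "{..<length I}" I] by (simp add: algorithm_def unserved_def)

lemma length_algorithm_le: "length (algorithm J I) \<le> length I"
  using length_schedule_le[of "{..<length I}" I] by (simp add: algorithm_def)

lemma algorithm_eq_map:
  "algorithm J I = map (\<lambda>k. \<lparr>time = trigger_time J I (unserved J I k), items = {0},
     served = unserved J I k - unserved J I (Suc k)\<rparr>) [0..<length (algorithm J I)]"
  using schedule_nth[of "{..<length I}" _ I]
  by (intro nth_equalityI) (simp_all add: algorithm_def unserved_def)

lemma trigger_time_mono:
  assumes "j \<le> k" "k < length (algorithm J I)"
  shows "trigger_time J I (unserved J I j) \<le> trigger_time J I (unserved J I k)"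
  using assms
proof (induction rule: dec_induct)
  case (step k)
  obtain i where i: "i \<in> unserved J I (Suc k)"
    "deadline (I ! i) \<le> trigger_time J I (unserved J I (Suc k))"
    using trigger_overdue[OF finite_unserved unserved_nonempty[OF step.prems]
        trigger_ratio_nonneg, of "\<lambda>i. deadline (I ! i)"]
    by (auto simp: trigger_time_def)
  then have "trigger_time J I (unserved J I k) < deadline (I ! i)"
    by (auto simp: unserved_Suc dest: postponedD)
  with step i show ?case by simp
qed simp

text \<open>
  Let an offline solution satisfy request \<open>i\<close> at time \<open>x i\<close>. If it does nothing between two
  consecutive services of the algorithm, then each request charged to the second one is satisfied
  either before the first or after the second. Whether the holding cost or the backlog cost is the
  smaller one is monotone in the deadline; so either all overdue requests cost at least what they
  cost the algorithm, or the requests held up to some overdue one, which exceeded the holding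
  budget of the first service, cost at least their holding cost.
\<close>

lemma idle_phase_cost:
  fixes x :: "nat \<Rightarrow> real"
  assumes k: "k < length (algorithm J I)"
    and b: "backlog_rate J > 0 \<or> order_cost J = 0"
    and x: "\<And>i. i < length I \<Longrightarrow> arrival (I ! i) \<le> x i"
    and idle: "\<And>i. i < length I \<Longrightarrow> trigger_time J I (unserved J I k) < x i \<or>
      (\<exists>j. k = Suc j \<and> x i \<le> trigger_time J I (unserved J I j))"
  shows "order_cost J \<le> (\<Sum>i\<in>charged J I k. delay_cost J (I ! i) (x i))"
proof -
  let ?t = "trigger_time J I (unserved J I k)" and ?d = "\<lambda>i. deadline (I ! i)"
  let ?B = "{i\<in>unserved J I k. ?d i \<le> ?t}"
  have n: "i < length I" if "i \<in> unserved J I l" for i l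
    using that unserved_bounded by blast
  have fin: "finite (charged J I k)" by (rule finite_subset[OF charged_bounded]) simp
  have nn: "holding_rate J \<ge> 0" "backlog_rate J \<ge> 0" using single_item_simps by auto
  have late: "backlog_rate J * (?t - ?d i) \<le> delay_cost J (I ! i) (x i)"
    if "?t < x i" "?d i \<le> ?t" for i
    using that nn by (auto simp: delay_cost_def intro!: mult_left_mono)
  show ?thesis
  proof (cases "\<exists>j q. k = Suc j \<and> q \<in> ?B \<and> arrival (I ! q) \<le> trigger_time J I (unserved J I j) \<and>
      holding_rate J * (?d q - trigger_time J I (unserved J I j)) \<le> backlog_rate J * (?t - ?d q)")
    case False
    have "backlog_rate J * (?t - ?d i) \<le> delay_cost J (I ! i) (x i)" if i: "i \<in> ?B" for i
    proof (cases "?t < x i")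
      case early: False
      then obtain j where j: "k = Suc j" "x i \<le> trigger_time J I (unserved J I j)"
        using idle[of i] n i by blast
      let ?u = "trigger_time J I (unserved J I j)"
      \<comment> \<open>Since \<open>x i\<close> is at most \<open>?u\<close>, request
        \<open>i\<close> had arrived by \<open>?u\<close>; so the failure of the case condition says
        that holding it from \<open>?u\<close> costs more than its backlog at
        \<open>?t\<close>.\<close>
      have "backlog_rate J * (?t - ?d i) \<le> holding_rate J * (?d i - ?u)"
        using False i j x[of i] n[of i k] by force
      also have "\<dots> \<le> holding_rate J * (?d i - x i)"
        using j nn by (intro mult_left_mono) auto
      also have "\<dots> = delay_cost J (I ! i) (x i)"
        using i j postponedD[of i J I "unserved J I j"] by (auto simp: delay_cost_def unserved_Suc)
      finally show ?thesis .
    qed (use late i in auto)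
    then have "(\<Sum>i\<in>?B. backlog_rate J * (?t - ?d i)) \<le> (\<Sum>i\<in>?B. delay_cost J (I ! i) (x i))"
      by (rule sum_mono)
    also have "\<dots> \<le> (\<Sum>i\<in>charged J I k. delay_cost J (I ! i) (x i))"
      using fin by (intro sum_mono2) (auto simp: charged_def delay_cost_nonneg)
    finally show ?thesis
      using overdue_cost_eq[OF finite_unserved unserved_nonempty[OF k] b, of I] by simp
  next
    case True
    then obtain j q where j: "k = Suc j" and q: "q \<in> ?B"
      "arrival (I ! q) \<le> trigger_time J I (unserved J I j)"
      "holding_rate J * (?d q - trigger_time J I (unserved J I j)) \<le> backlog_rate J * (?t - ?d q)"
      by blast
    let ?u = "trigger_time J I (unserved J I j)" and ?D = "held_upto I (unserved J I j) (trigger_time J I (unserved J I j)) q"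
    have "q \<in> postponed J I (unserved J I j)" using q(1) by (simp add: j unserved_Suc)
    then have "order_cost J \<le> (\<Sum>r\<in>?D. holding_rate J * (?d r - ?u))"
      using q(2) by (auto simp: postponed_def Let_def)
    also have "\<dots> \<le> (\<Sum>r\<in>?D. delay_cost J (I ! r) (x r))"
    proof (rule sum_mono)
      fix r assume r: "r \<in> ?D"
      have rn: "r < length I" using r n by (auto simp: held_upto_def)
      show "holding_rate J * (?d r - ?u) \<le> delay_cost J (I ! r) (x r)"
      proof (cases "?t < x r")
        case True
        have "holding_rate J * (?d r - ?u) \<le> holding_rate J * (?d q - ?u)"
          using r nn by (intro mult_left_mono) (auto simp: held_upto_def)
        also have "\<dots> \<le> backlog_rate J * (?t - ?d q)" by (rule q)
        also have "\<dots> \<le> backlog_rate J * (?t - ?d r)"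
          using r nn by (intro mult_left_mono) (auto simp: held_upto_def)
        also have "\<dots> \<le> delay_cost J (I ! r) (x r)"
          using r q by (intro late True) (auto simp: held_upto_def)
        finally show ?thesis .
      next
        case False
        then have "x r \<le> ?u" using idle[OF rn] j by auto
        then show ?thesis
          using r nn by (auto simp: delay_cost_def held_upto_def intro!: mult_left_mono)
      qed
    qed
    \<comment> \<open>A request in \<open>?D\<close> was either held by the service at
      \<open>?u\<close>, or postponed and then overdue at \<open>?t\<close>, because its deadline is
      at most that of \<open>q\<close>. Both kinds are charged to \<open>k\<close>.\<close>
    also have "\<dots> \<le> (\<Sum>i\<in>charged J I k. delay_cost J (I ! i) (x i))"
      using fin q(1) by (intro sum_mono2) (auto simp: charged_def held_upto_def j delay_cost_nonneg)
    finally show ?thesis .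
  qed
qed

text \<open>An interval containing an offline service time is paid for by an order; any other
  interval is paid for by \<open>idle_phase_cost\<close>. Disjoint charges ensure that no delay cost
  is used twice.\<close>

lemma phases_cost:
  fixes x :: "nat \<Rightarrow> real"
  assumes b: "backlog_rate J > 0 \<or> order_cost J = 0"
    and x: "\<And>i. i < length I \<Longrightarrow> arrival (I ! i) \<le> x i"
  shows "order_cost J * real (length (algorithm J I)) \<le>
    order_cost J * real (card (x ` {..<length I})) + (\<Sum>i<length I. delay_cost J (I ! i) (x i))"
proof -
  let ?m = "length (algorithm J I)" and ?X = "x ` {..<length I}"
  let ?t = "\<lambda>k. trigger_time J I (unserved J I k)"
  define hit where "hit = {k. k < ?m \<and> (\<exists>w\<in>?X. w \<le> ?t k \<and> (\<forall>j<k. ?t j < w))}"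
  define miss where "miss = {..<?m} - hit"
  \<comment> \<open>An offline time \<open>w\<close> hits only the interval ending at the first
    trigger not before \<open>w\<close>, so \<open>hit\<close> has at most as many elements as
    \<open>?X\<close>.\<close>
  have "hit \<subseteq> (\<lambda>w. LEAST k. w \<le> ?t k) ` ?X"
  proof
    fix k assume "k \<in> hit"
    then obtain w where w: "w \<in> ?X" "w \<le> ?t k" "\<forall>j<k. ?t j < w" by (auto simp: hit_def)
    have "(LEAST k. w \<le> ?t k) = k"
      using w(2,3) by (intro Least_equality) (auto simp: not_less[symmetric])
    with w(1) show "k \<in> (\<lambda>w. LEAST k. w \<le> ?t k) ` ?X" by force
  qed
  then have hit_le: "card hit \<le> card ?X"
    by (meson card_image_le card_mono finite_imageI finite_lessThan order.trans)
  have idle: "?t k < x i \<or> (\<exists>j. k = Suc j \<and> x i \<le> ?t j)" if "k \<in> miss" "i < length I" for k i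
  proof (rule disjCI)
    assume *: "\<not> (\<exists>j. k = Suc j \<and> x i \<le> ?t j)"
    have "?t j < x i" if j: "j < k" for j
    proof -
      obtain l where l: "k = Suc l" "j \<le> l" using j by (cases k) auto
      then have "?t j \<le> ?t l" using \<open>k \<in> miss\<close> by (intro trigger_time_mono) (auto simp: miss_def)
      then show ?thesis using * l by auto
    qed
    with that show "?t k < x i" by (force simp: miss_def hit_def)
  qed
  have fin: "finite miss" "finite hit" by (auto simp: miss_def hit_def)
  have "?m = card hit + card miss"
  proof -
    have "{..<?m} = hit \<union> miss" "hit \<inter> miss = {}" by (auto simp: miss_def hit_def)
    then show ?thesis using card_Un_disjoint[OF fin(2,1)] by (metis card_lessThan)
  qed
  then have "order_cost J * real ?m = order_cost J * real (card hit) + (\<Sum>k\<in>miss. order_cost J)"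
    by (simp add: algebra_simps)
  also have "\<dots> \<le> order_cost J * real (card ?X) + (\<Sum>k\<in>miss. \<Sum>i\<in>charged J I k. delay_cost J (I ! i) (x i))"
    using hit_le single_item_simps
    by (intro add_mono mult_left_mono sum_mono idle_phase_cost b x idle) (auto simp: miss_def)
  also have "(\<Sum>k\<in>miss. \<Sum>i\<in>charged J I k. delay_cost J (I ! i) (x i)) =
      (\<Sum>i\<in>(\<Union>k\<in>miss. charged J I k). delay_cost J (I ! i) (x i))"
  proof (intro sum.UNION_disjoint[symmetric] ballI impI fin)
    show "finite (charged J I k)" for k by (rule finite_subset[OF charged_bounded]) simp
    show "charged J I j \<inter> charged J I k = {}" if "j \<noteq> k" for j k
      using that charged_disjoint[of j k] charged_disjoint[of k j] by (cases j k rule: linorder_cases) auto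
  qed
  also have "\<dots> \<le> (\<Sum>i<length I. delay_cost J (I ! i) (x i))"
    using charged_bounded delay_cost_nonneg by (intro sum_mono2) auto
  finally show ?thesis by simp
qed

text \<open>This reduces a solution to the times at which it serves the requests. Counting distinct
  times ignores services that satisfy nothing and merges simultaneous ones, which only lowers the
  bound. A service that satisfies something must contain leaf \<open>0\<close>, so it costs the full
  order cost.\<close>

lemma total_cost_ge:
  assumes f: "feasible J I S"
  shows "\<exists>x. (\<forall>i<length I. arrival (I ! i) \<le> x i) \<and>
    order_cost J * real (card (x ` {..<length I})) + (\<Sum>i<length I. delay_cost J (I ! i) (x i))
      \<le> total_cost J I S"
proof -
  have "\<forall>i<length I. \<exists>k<length S. i \<in> served (S ! k)"
    using f by (auto simp: feasible_def)
  then obtain \<kappa> where \<kappa>: "\<And>i. i < length I \<Longrightarrow> \<kappa> i < length S \<and> i \<in> served (S ! \<kappa> i)" by metis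
  have uniq: "l = \<kappa> i" if "i < length I" "l < length S" "i \<in> served (S ! l)" for i l
    using f \<kappa>[OF that(1)] that by (auto simp: feasible_def)
  define x where "x i = time (S ! \<kappa> i)" for i
  let ?W = "\<kappa> ` {..<length I}"
  have S: "items (S ! k) \<subseteq> {0}" "served (S ! k) \<subseteq> {..<length I}"
      "\<forall>i\<in>served (S ! k). item (I ! i) \<in> items (S ! k) \<and> arrival (I ! i) \<le> time (S ! k)"
    if "k < length S" for k
    using f nth_mem[OF that] single_item_simps(1) unfolding feasible_def by force+
  have "root_cost J \<ge> 0" "leaf_cost J 0 \<ge> 0" using J by (auto simp: single_item_def valid_problem_def)
  then have sc: "0 \<le> service_cost J (S ! k)" "k \<in> ?W \<Longrightarrow> service_cost J (S ! k) = order_cost J"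
    if "k < length S" for k
  proof -
    have "items (S ! k) = {0} \<or> items (S ! k) = {}" using S(1)[OF that] by auto
    moreover have "items (S ! k) \<noteq> {}" if "k \<in> ?W"
    proof -
      from that obtain i where "i < length I" "k = \<kappa> i" by blast
      then show ?thesis using \<kappa>[of i] S(3)[OF \<open>k < length S\<close>] by auto
    qed
    ultimately show "0 \<le> service_cost J (S ! k)" "k \<in> ?W \<Longrightarrow> service_cost J (S ! k) = order_cost J"
      using \<open>root_cost J \<ge> 0\<close> \<open>leaf_cost J 0 \<ge> 0\<close> by (auto simp: service_cost_def order_cost_def)
  qed
  have "x ` {..<length I} = (\<lambda>k. time (S ! k)) ` ?W" by (auto simp: x_def)
  then have "card (x ` {..<length I}) \<le> card ?W" by (simp add: card_image_le)
  then have "order_cost J * real (card (x ` {..<length I})) \<le> order_cost J * real (card ?W)"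
    using single_item_simps by (intro mult_left_mono) auto
  also have "\<dots> = (\<Sum>k\<in>?W. service_cost J (S ! k))"
    using sc \<kappa> by (simp add: image_iff) (subst sum.cong[OF refl, of _ _ "\<lambda>_. order_cost J"], auto)
  also have "\<dots> \<le> (\<Sum>k<length S. service_cost J (S ! k))"
    using sc \<kappa> by (intro sum_mono2) auto
  finally have 1: "order_cost J * real (card (x ` {..<length I})) \<le> (\<Sum>k<length S. service_cost J (S ! k))" .
  have "(\<Sum>i<length I. delay_cost J (I ! i) (x i)) =
      (\<Sum>k<length S. \<Sum>i | i \<in> {..<length I} \<and> \<kappa> i = k. delay_cost J (I ! i) (x i))"
    using \<kappa> by (intro sum.group[symmetric]) auto
  also have "\<dots> = (\<Sum>k<length S. \<Sum>i\<in>served (S ! k). delay_cost J (I ! i) (time (S ! k)))"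
  proof (intro sum.cong refl)
    fix k assume "k \<in> {..<length S}"
    then show "{i. i \<in> {..<length I} \<and> \<kappa> i = k} = served (S ! k)"
      using S(2)[of k] \<kappa> uniq by auto
  next
    fix k i assume "k \<in> {..<length S}" "i \<in> served (S ! k)"
    then have "k = \<kappa> i" using S(2)[of k] uniq by blast
    then show "delay_cost J (I ! i) (x i) = delay_cost J (I ! i) (time (S ! k))" by (simp add: x_def)
  qed
  finally have 2: "(\<Sum>i<length I. delay_cost J (I ! i) (x i)) =
      (\<Sum>k<length S. \<Sum>i\<in>served (S ! k). delay_cost J (I ! i) (time (S ! k)))" .
  have "total_cost J I S = (\<Sum>k<length S. service_cost J (S ! k) +
      (\<Sum>i\<in>served (S ! k). delay_cost J (I ! i) (time (S ! k))))"
    by (simp add: total_cost_def sum_list_sum_nth atLeast0LessThan)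
  with 1 2 have "order_cost J * real (card (x ` {..<length I})) + (\<Sum>i<length I. delay_cost J (I ! i) (x i))
      \<le> total_cost J I S" by (simp add: sum.distrib)
  moreover have "\<forall>i<length I. arrival (I ! i) \<le> x i"
    using \<kappa> S(3) by (auto simp: x_def)
  ultimately show ?thesis by blast
qed

lemma competitive_algorithm:
  assumes "backlog_rate J > 0 \<or> order_cost J = 0"
  shows "competitive J 3 (algorithm J)"
  unfolding competitive_def
proof (intro allI impI)
  fix I assume v: "valid_requests J I"
  have "order_cost J * real (length (algorithm J I)) \<le> opt J I"
    unfolding opt_def
  proof (rule cInf_greatest)
    show "{total_cost J I S |S. feasible J I S} \<noteq> {}" using feasible_algorithm[OF v] by blast
    fix c assume "c \<in> {total_cost J I S |S. feasible J I S}"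
    then obtain S where S: "feasible J I S" "c = total_cost J I S" by blast
    obtain x where "\<forall>i<length I. arrival (I ! i) \<le> x i"
      "order_cost J * real (card (x ` {..<length I})) + (\<Sum>i<length I. delay_cost J (I ! i) (x i)) \<le> c"
      using total_cost_ge[OF S(1)] S(2) by blast
    then show "order_cost J * real (length (algorithm J I)) \<le> c"
      using phases_cost[OF assms, of I x] by force
  qed
  then show "total_cost J I (algorithm J I) \<le> 3 * opt J I"
    using total_cost_schedule[of "{..<length I}" I] by (simp add: algorithm_def)
qed

end

section \<open>Polynomial running time\<close>

text \<open>Total correctness with a step bound. With the state as last argument,
  \<open>halts_within c B Q\<close> can itself serve as a postcondition, so sequences are verified
  front to back by nesting.\<close>

definition halts_within :: "com \<Rightarrow> nat \<Rightarrow> (state \<Rightarrow> bool) \<Rightarrow> state \<Rightarrow> bool" where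
  "halts_within c B Q s \<longleftrightarrow> (\<exists>t s'. run c s t s' \<and> t \<le> B \<and> Q s')"

lemma halts_Skip: "1 \<le> B \<Longrightarrow> Q s \<Longrightarrow> halts_within Skip B Q s"
  unfolding halts_within_def using run.Skip by blast

lemma halts_ISet: "Q (set_int x (ival i s) (ival e s) s) \<Longrightarrow> halts_within (ISet x i e) 1 Q s"
  unfolding halts_within_def using run.ISet by blast

lemma halts_RSet: "Q (set_real x (ival i s) (rval e s) s) \<Longrightarrow> halts_within (RSet x i e) 1 Q s"
  unfolding halts_within_def using run.RSet by blast

lemma halts_Seq:
  "halts_within c1 B1 (halts_within c2 B2 Q) s \<Longrightarrow> halts_within (Seq c1 c2) (B1 + B2) Q s"
  unfolding halts_within_def using run.Seq add_mono by meson

lemma halts_If: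
  assumes "bval b s \<Longrightarrow> halts_within c1 B Q s" "\<not> bval b s \<Longrightarrow> halts_within c2 B Q s"
  shows "halts_within (If b c1 c2) (Suc B) Q s"
  using assms unfolding halts_within_def using run.IfTrue run.IfFalse by (meson Suc_le_mono)

lemma halts_weaken:
  "halts_within c B Q s \<Longrightarrow> B \<le> B' \<Longrightarrow> (\<And>s'. Q s' \<Longrightarrow> Q' s') \<Longrightarrow> halts_within c B' Q' s"
  unfolding halts_within_def by (meson order.trans)

text \<open>The number \<open>m\<close> of rounds is fixed in advance and indexes the invariant.
  Each round adds one step for its guard, and the final failing test adds one more.\<close>

lemma halts_While:
  assumes step: "\<And>k s. k < m \<Longrightarrow> Inv k s \<Longrightarrow> bval b s \<and> halts_within c B (Inv (Suc k)) s"
    and stop: "\<And>s. Inv m s \<Longrightarrow> \<not> bval b s" and init: "Inv 0 s"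
  shows "halts_within (While b c) (m * (B + 1) + 1) (Inv m) s"
proof -
  have "halts_within (While b c) (l * (B + 1) + 1) (Inv m) s" if "Inv (m - l) s" "l \<le> m" for l s
    using that
  proof (induction l arbitrary: s)
    case 0
    then show ?case using stop[of s] run.WhileFalse unfolding halts_within_def by force
  next
    case (Suc l)
    then obtain t1 s1 where 1: "bval b s" "run c s t1 s1" "t1 \<le> B" "Inv (m - l) s1"
      using step[of "m - Suc l" s] by (auto simp: halts_within_def Suc_diff_Suc)
    then obtain t2 s2 where 2: "run (While b c) s1 t2 s2" "t2 \<le> l * (B + 1) + 1" "Inv m s2"
      using Suc by (force simp: halts_within_def)
    have "run (While b c) s (Suc (t1 + t2)) s2" using 1 2 run.WhileTrue by blast
    moreover have "Suc (t1 + t2) \<le> Suc l * (B + 1) + 1" using 1(3) 2(2) by simp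
    ultimately show ?case using 2(3) unfolding halts_within_def by blast
  qed
  from this[of m] init show ?thesis by simp
qed

definition for_loop :: "string \<Rightarrow> com \<Rightarrow> com" where
  "for_loop v c = Seq (ISet v (INum 0) (INum 0))
     (While (ILess (IGet v (INum 0)) (IGet ''num_requests'' (INum 0)))
        (Seq c (ISet v (INum 0) (IPlus (IGet v (INum 0)) (INum 1)))))"

text \<open>The two extra steps per round are guard and increment; the two outside are
  initialisation and the last test. The increment is folded into the postcondition of the
  body.\<close>

lemma halts_for_loop:
  assumes init: "Inv 0 (set_int v 0 0 s)"
    and counter: "\<And>r s. Inv r s \<Longrightarrow> ints s v 0 = r \<and> ints s ''num_requests'' 0 = n"
    and body: "\<And>r s. r < n \<Longrightarrow> Inv r s \<Longrightarrow>
      halts_within c B (\<lambda>s'. Inv (Suc r) (set_int v 0 (Suc (ints s' v 0)) s')) s"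
    and post: "\<And>s. Inv n s \<Longrightarrow> Q s"
  shows "halts_within (for_loop v c) (n * (B + 2) + 2) Q s"
proof -
  let ?W = "While (ILess (IGet v (INum 0)) (IGet ''num_requests'' (INum 0)))
        (Seq c (ISet v (INum 0) (IPlus (IGet v (INum 0)) (INum 1))))"
  have "halts_within ?W (n * ((B + 1) + 1) + 1) (Inv n) (set_int v 0 0 s)"
  proof (rule halts_While[where Inv = Inv], intro conjI)
    fix k s' assume k: "k < n" "Inv k s'"
    then show "bval (ILess (IGet v (INum 0)) (IGet ''num_requests'' (INum 0))) s'"
      using counter by simp
    show "halts_within (Seq c (ISet v (INum 0) (IPlus (IGet v (INum 0)) (INum 1)))) (B + 1) (Inv (Suc k)) s'"
      by (rule halts_Seq, rule halts_weaken[OF body[OF k] order.refl], rule halts_ISet) simp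
  qed (use counter init in simp_all)
  then have "halts_within (for_loop v c) (1 + (n * ((B + 1) + 1) + 1)) (Inv n) s"
    unfolding for_loop_def by (intro halts_Seq halts_ISet) simp
  then show ?thesis by (rule halts_weaken) (use post in \<open>simp_all add: algebra_simps\<close>)
qed

section \<open>State updates, frame conditions and summation loops\<close>

lemma set_int_simps [simp]:
  "ints (set_int x i a s) y j = (if y = x \<and> j = i then a else ints s y j)"
  "reals (set_int x i a s) = reals s"
  by (auto simp: set_int_def)

lemma set_real_simps [simp]:
  "reals (set_real x i a s) y j = (if y = x \<and> j = i then a else reals s y j)"
  "ints (set_real x i a s) = ints s"
  by (auto simp: set_real_def)

text \<open>A frame condition: each program piece is specified together with the names that it may
  overwrite, and a name covers the integer and the real array alike.\<close>

definition same_outside :: "string set \<Rightarrow> state \<Rightarrow> state \<Rightarrow> bool" where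
  "same_outside X s s' \<longleftrightarrow> (\<forall>x. x \<notin> X \<longrightarrow> ints s' x = ints s x \<and> reals s' x = reals s x)"

lemma same_outside_refl [simp]: "same_outside X s s"
  by (simp add: same_outside_def)

lemma same_outside_trans:
  "same_outside X s s' \<Longrightarrow> same_outside Y s' s'' \<Longrightarrow> X \<union> Y \<subseteq> Z \<Longrightarrow> same_outside Z s s''"
  unfolding same_outside_def by (metis UnCI subsetD)

lemma same_outside_set_int [simp]:
  "x \<in> X \<Longrightarrow> same_outside X s (set_int x i a s') \<longleftrightarrow> same_outside X s s'"
  unfolding same_outside_def by (auto simp: set_int_def)

lemma same_outside_set_real [simp]:
  "x \<in> X \<Longrightarrow> same_outside X s (set_real x i a s') \<longleftrightarrow> same_outside X s s'"
  unfolding same_outside_def by (auto simp: set_real_def)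

definition sum_loop :: "string \<Rightarrow> bexp \<Rightarrow> rexp \<Rightarrow> com" where
  "sum_loop x b e = Seq (RSet x (INum 0) (RInt (INum 0)))
     (for_loop ''j'' (If b (RSet x (INum 0) (RPlus (RGet x (INum 0)) e)) Skip))"

lemma halts_sum_loop:
  assumes x: "x \<noteq> ''num_requests''" and n: "ints s ''num_requests'' 0 = n" and K: "K \<subseteq> {..<n}"
    and body: "\<And>s'. same_outside {''j'', x} s s' \<Longrightarrow> ints s' ''j'' 0 < n \<Longrightarrow>
      (bval b s' \<longleftrightarrow> ints s' ''j'' 0 \<in> K) \<and> rval e s' = f (ints s' ''j'' 0)"
    and post: "\<And>s'. same_outside {''j'', x} s s' \<Longrightarrow> reals s' x 0 = sum f K \<Longrightarrow> Q s'"
  shows "halts_within (sum_loop x b e) (4 * n + 3) Q s"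
proof -
  let ?Inv = "\<lambda>r s'. same_outside {''j'', x} s s' \<and> ints s' ''j'' 0 = r \<and>
    reals s' x 0 = sum f {i\<in>K. i < r}"
  have fin: "finite K" using K finite_subset by blast
  have sum_Suc: "sum f {i\<in>K. i < Suc r} = sum f {i\<in>K. i < r} + (if r \<in> K then f r else 0)" for r
  proof -
    have "{i\<in>K. i < Suc r} = (if r \<in> K then insert r {i\<in>K. i < r} else {i\<in>K. i < r})"
      by (auto simp: less_Suc_eq)
    then show ?thesis using fin by simp
  qed
  have "halts_within (sum_loop x b e) (1 + (n * (Suc 1 + 2) + 2)) Q s"
    unfolding sum_loop_def
  proof (intro halts_Seq halts_RSet halts_for_loop[where Inv = ?Inv])
    fix r s' assume "?Inv r s'"
    moreover from this have "ints s' ''num_requests'' = ints s ''num_requests''"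
      using x by (simp add: same_outside_def)
    ultimately show "ints s' ''j'' 0 = r \<and> ints s' ''num_requests'' 0 = n" using n by simp
  next
    fix r s' assume r: "r < n" "?Inv r s'"
    then have "(bval b s' \<longleftrightarrow> r \<in> K) \<and> rval e s' = f r" using body[of s'] by simp
    with r show "halts_within (If b (RSet x (INum 0) (RPlus (RGet x (INum 0)) e)) Skip) (Suc 1)
        (\<lambda>s''. ?Inv (Suc r) (set_int ''j'' 0 (Suc (ints s'' ''j'' 0)) s'')) s'"
      by (intro halts_If halts_RSet halts_Skip) (simp_all add: sum_Suc)
  next
    fix s' assume s': "?Inv n s'"
    moreover have "{i\<in>K. i < n} = K" using K by auto
    ultimately show "Q s'" using post by simp
  qed simp
  then show ?thesis by (rule halts_weaken) simp_all
qed

section \<open>The program\<close>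

abbreviation less_eq_expr :: "rexp \<Rightarrow> rexp \<Rightarrow> bexp" where
  "less_eq_expr e1 e2 \<equiv> BNot (RLess e2 e1)"

abbreviation at_index :: "string \<Rightarrow> string \<Rightarrow> rexp" where
  "at_index x v \<equiv> RGet x (IGet v (INum 0))"

abbreviation order_cost_expr :: rexp where
  "order_cost_expr \<equiv> RPlus (RGet ''root_cost'' (INum 0)) (RGet ''leaf_cost'' (INum 0))"

abbreviation unserved_expr :: "string \<Rightarrow> bexp" where
  "unserved_expr v \<equiv>
     BNot (ILess (IGet ''assigned'' (IGet v (INum 0))) (IGet ''num_services'' (INum 0)))"

abbreviation prefix_expr :: bexp where
  "prefix_expr \<equiv>
     BAnd (unserved_expr ''j'') (less_eq_expr (at_index ''deadline'' ''j'') (at_index ''deadline'' ''i''))"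

definition set_candidate :: com where
  "set_candidate = RSet ''candidate'' (INum 0)
     (RDivide
       (RPlus (RDivide order_cost_expr (RGet ''backlog_rate'' (INum 0))) (RGet ''sum'' (INum 0)))
       (RGet ''count'' (INum 0)))"

text \<open>The flag \<open>found\<close> replaces an infinite initial minimum. For a request
  already served, the candidate may be a quotient with divisor \<open>0\<close>; the first test
  discards it.\<close>

definition lower_time :: com where
  "lower_time =
     If (BAnd (unserved_expr ''i'')
          (BNot (BAnd (ILess (INum 0) (IGet ''found'' (INum 0)))
             (RLess (at_index ''time'' ''num_services'') (RGet ''candidate'' (INum 0))))))
       (Seq (RSet ''time'' (IGet ''num_services'' (INum 0)) (RGet ''candidate'' (INum 0)))
         (ISet ''found'' (INum 0) (INum 1)))
       Skip"

definition find_trigger :: com where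
  "find_trigger = Seq (ISet ''found'' (INum 0) (INum 0)) (for_loop ''i''
     (Seq (sum_loop ''sum'' prefix_expr (at_index ''deadline'' ''j''))
     (Seq (sum_loop ''count'' prefix_expr (RInt (INum 1)))
     (Seq set_candidate lower_time))))"

definition held_expr :: bexp where
  "held_expr = BAnd (unserved_expr ''j'')
     (BAnd (less_eq_expr (at_index ''arrival'' ''j'') (at_index ''time'' ''num_services''))
     (BAnd (RLess (at_index ''time'' ''num_services'') (at_index ''deadline'' ''j''))
       (less_eq_expr (at_index ''deadline'' ''j'') (at_index ''deadline'' ''i''))))"

definition postpone_expr :: bexp where
  "postpone_expr = BAnd (unserved_expr ''i'')
     (BAnd (RLess (at_index ''time'' ''num_services'') (at_index ''deadline'' ''i''))
       (BNot (BAnd (less_eq_expr (at_index ''arrival'' ''i'') (at_index ''time'' ''num_services''))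
         (less_eq_expr (RGet ''sum'' (INum 0)) order_cost_expr))))"

text \<open>Updating in place is safe: the raised entry still passes \<open>unserved_expr\<close>,
  so the later sums of the same round range over the same set of requests.\<close>

definition assign_next :: com where
  "assign_next = If postpone_expr
     (Seq (ISet ''assigned'' (IGet ''i'' (INum 0)) (IPlus (IGet ''num_services'' (INum 0)) (INum 1)))
       (ISet ''more'' (INum 0) (INum 1)))
     Skip"

definition postpone :: com where
  "postpone = Seq (ISet ''more'' (INum 0) (INum 0)) (for_loop ''i''
     (Seq (sum_loop ''sum'' held_expr (RTimes (RGet ''holding_rate'' (INum 0))
            (RMinus (at_index ''deadline'' ''j'') (at_index ''time'' ''num_services''))))
       assign_next))"

text \<open>Starting \<open>more\<close> at the number of requests skips the loop on empty input.
  With a single leaf, row \<open>k\<close> of the incidence matrix is just cell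
  \<open>k\<close>.\<close>

definition algorithm_program :: com where
  "algorithm_program = Seq (ISet ''more'' (INum 0) (IGet ''num_requests'' (INum 0)))
     (While (ILess (INum 0) (IGet ''more'' (INum 0)))
       (Seq find_trigger (Seq postpone
         (Seq (ISet ''included'' (IGet ''num_services'' (INum 0)) (INum 1))
           (ISet ''num_services'' (INum 0) (IPlus (IGet ''num_services'' (INum 0)) (INum 1)))))))"

section \<open>Memory contents during planning\<close>

definition inputs_loaded :: "jrp \<Rightarrow> request list \<Rightarrow> state \<Rightarrow> bool" where
  "inputs_loaded J I s \<longleftrightarrow>
     ints s ''num_requests'' 0 = length I \<and>
     (\<forall>i<length I. reals s ''arrival'' i = arrival (I ! i) \<and> reals s ''deadline'' i = deadline (I ! i)) \<and>
     reals s ''root_cost'' 0 + reals s ''leaf_cost'' 0 = order_cost J \<and>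
     reals s ''holding_rate'' 0 = holding_rate J \<and> reals s ''backlog_rate'' 0 = backlog_rate J"

text \<open>
  While service \<open>k\<close> is being planned, the entries \<open>assigned\<close> of the unserved requests are at least
  \<open>k\<close>; postponing a request raises its entry to \<open>k + 1\<close>.
\<close>

definition planning :: "jrp \<Rightarrow> request list \<Rightarrow> nat \<Rightarrow> nat set \<Rightarrow> state \<Rightarrow> bool" where
  "planning J I k U s \<longleftrightarrow> inputs_loaded J I s \<and> ints s ''num_services'' 0 = k \<and>
     (\<forall>i<length I. k \<le> ints s ''assigned'' i \<longleftrightarrow> i \<in> U)"

abbreviation read_names :: "string set" where
  "read_names \<equiv> {''num_requests'', ''arrival'', ''deadline'', ''root_cost'', ''leaf_cost'',
     ''holding_rate'', ''backlog_rate'', ''num_services''}"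

lemma inputs_same_outside:
  assumes "inputs_loaded J I s" "same_outside X s s'" "X \<inter> read_names = {}"
  shows "inputs_loaded J I s' \<and> ints s' ''num_services'' = ints s ''num_services''"
proof -
  have "ints s' x = ints s x" "reals s' x = reals s x" if "x \<in> read_names" for x
    using assms(2,3) that by (auto simp: same_outside_def)
  with assms(1) show ?thesis by (simp add: inputs_loaded_def)
qed

lemma planning_same_outside:
  assumes "planning J I k U s" "same_outside X s s'" "X \<inter> read_names = {}" "''assigned'' \<notin> X"
  shows "planning J I k U s'"
proof -
  have "ints s' ''assigned'' = ints s ''assigned''"
    using assms(2,4) by (simp add: same_outside_def)
  then show ?thesis
    using assms(1) inputs_same_outside[of J I, OF _ assms(2,3)] by (simp add: planning_def)
qed

section \<open>Correctness and cost of one planning round\<close>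

lemma halts_find_trigger:
  assumes pl: "planning J I k U s0" and U: "U \<subseteq> {..<length I}" "U \<noteq> {}"
    and post: "\<And>s. same_outside {''i'', ''j'', ''found'', ''sum'', ''count'', ''candidate'', ''time''} s0 s \<Longrightarrow>
      reals s ''time'' k = trigger_time J I U \<Longrightarrow>
      (\<And>l. l \<noteq> k \<Longrightarrow> reals s ''time'' l = reals s0 ''time'' l) \<Longrightarrow> Q s"
  shows "halts_within find_trigger (length I * (8 * length I + 12) + 3) Q s0"
proof -
  let ?n = "length I" and ?d = "\<lambda>i. deadline (I ! i)"
  let ?X = "{''i'', ''j'', ''found'', ''sum'', ''count'', ''candidate'', ''time''}"
  let ?K = "\<lambda>r. {i\<in>U. ?d i \<le> ?d r}"
  define cand where "cand r =
    (order_cost J / backlog_rate J + (\<Sum>i\<in>?K r. ?d i)) / real (card (?K r))" for r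
  \<comment> \<open>A running minimum over the unserved requests below \<open>r\<close>.
    \<open>Min\<close> is unspecified on the empty set, so \<open>found\<close> covers the time
    before the first of them.\<close>
  define Inv where "Inv r s \<longleftrightarrow> same_outside ?X s0 s \<and> ints s ''i'' 0 = r \<and>
    (\<forall>l. l \<noteq> k \<longrightarrow> reals s ''time'' l = reals s0 ''time'' l) \<and>
    (if {i\<in>U. i < r} = {} then ints s ''found'' 0 = 0
     else 0 < ints s ''found'' 0 \<and> reals s ''time'' k = Min (cand ` {i\<in>U. i < r}))" for r s
  have fin: "finite U" using U(1) finite_subset by blast
  have planning: "planning J I k U s" if "Inv r s" for r s
    by (rule planning_same_outside[OF pl, of ?X]) (use that in \<open>simp_all add: Inv_def\<close>)
  let ?body = "((4 * ?n + 3) + ((4 * ?n + 3) + (1 + Suc (1 + 1))))"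
  have "halts_within find_trigger (1 + (?n * (?body + 2) + 2)) Q s0"
    unfolding find_trigger_def
  proof (rule halts_Seq, intro halts_ISet halts_for_loop[where Inv = Inv])
    show "Inv 0 (set_int ''i'' 0 0 (set_int ''found'' (ival (INum 0) s0) (ival (INum 0) s0) s0))"
      by (simp add: Inv_def)
  next
    fix r s assume "Inv r s"
    with planning show "ints s ''i'' 0 = r \<and> ints s ''num_requests'' 0 = ?n"
      by (auto simp: Inv_def planning_def inputs_loaded_def)
  next
    fix r s assume r: "r < ?n" and inv: "Inv r s"
    note pls = planning[OF inv]
    have ir: "ints s ''i'' 0 = r" using inv by (simp add: Inv_def)
    have K: "?K r \<subseteq> {..<?n}" using U by auto
    have prefix: "bval prefix_expr s' \<longleftrightarrow> ints s' ''j'' 0 \<in> ?K r"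
      if "planning J I k U s'" "ints s' ''i'' 0 = r" "ints s' ''j'' 0 < ?n" for s'
      using that r by (auto simp: planning_def inputs_loaded_def not_less)
    show "halts_within (Seq (sum_loop ''sum'' prefix_expr (at_index ''deadline'' ''j''))
       (Seq (sum_loop ''count'' prefix_expr (RInt (INum 1))) (Seq set_candidate lower_time))) ?body
       (\<lambda>s'. Inv (Suc r) (set_int ''i'' 0 (Suc (ints s' ''i'' 0)) s')) s"
    proof (rule halts_Seq, rule halts_sum_loop[where K = "?K r" and f = ?d])
      fix s' assume s': "same_outside {''j'', ''sum''} s s'" "ints s' ''j'' 0 < ?n"
      have p: "planning J I k U s'" by (rule planning_same_outside[OF pls s'(1)]) simp_all
      have "ints s' ''i'' 0 = r" using s'(1) ir by (simp add: same_outside_def)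
      from prefix[OF p this s'(2)] p s'(2)
      show "(bval prefix_expr s' \<longleftrightarrow> ints s' ''j'' 0 \<in> ?K r) \<and>
          rval (at_index ''deadline'' ''j'') s' = ?d (ints s' ''j'' 0)"
        by (auto simp: planning_def inputs_loaded_def)
    next
      fix s1 assume s1: "same_outside {''j'', ''sum''} s s1" and sum: "reals s1 ''sum'' 0 = sum ?d (?K r)"
      have pl1: "planning J I k U s1" by (rule planning_same_outside[OF pls s1]) simp_all
      have ir1: "ints s1 ''i'' 0 = r" using s1 ir by (simp add: same_outside_def)
      show "halts_within (Seq (sum_loop ''count'' prefix_expr (RInt (INum 1))) (Seq set_candidate lower_time))
          ((4 * ?n + 3) + (1 + Suc (1 + 1)))
          (\<lambda>s'. Inv (Suc r) (set_int ''i'' 0 (Suc (ints s' ''i'' 0)) s')) s1"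
      proof (rule halts_Seq, rule halts_sum_loop[where K = "?K r" and f = "\<lambda>_. 1"])
        fix s' assume s': "same_outside {''j'', ''count''} s1 s'" "ints s' ''j'' 0 < ?n"
        have p: "planning J I k U s'" by (rule planning_same_outside[OF pl1 s'(1)]) simp_all
        have "ints s' ''i'' 0 = r" using s'(1) ir1 by (simp add: same_outside_def)
        from prefix[OF p this s'(2)]
        show "(bval prefix_expr s' \<longleftrightarrow> ints s' ''j'' 0 \<in> ?K r) \<and> rval (RInt (INum 1)) s' = 1"
          by simp
      next
        fix s2 assume s2: "same_outside {''j'', ''count''} s1 s2"
          and count: "reals s2 ''count'' 0 = (\<Sum>i\<in>?K r. 1)"
        have pl2: "planning J I k U s2" by (rule planning_same_outside[OF pl1 s2]) simp_all
        have s12: "same_outside {''j'', ''sum'', ''count''} s s2"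
          by (rule same_outside_trans[OF s1 s2]) simp
        have eq: "ints s2 ''i'' 0 = r" "ints s2 ''found'' = ints s ''found''"
            "reals s2 ''time'' = reals s ''time''"
          using s12 ir by (auto simp: same_outside_def)
        have "reals s2 ''sum'' 0 = sum ?d (?K r)" using s2 sum by (simp add: same_outside_def)
        then have cand: "halts_within set_candidate 1 Q s2"
          if "Q (set_real ''candidate'' 0 (cand r) s2)" for Q
          unfolding set_candidate_def using count pl2 that
          by (intro halts_RSet) (simp add: cand_def planning_def inputs_loaded_def)
        have inv_same: "same_outside ?X s0 s" using inv by (simp add: Inv_def)
        have same: "same_outside ?X s0 s2" by (rule same_outside_trans[OF inv_same s12]) simp
        have others: "reals s2 ''time'' l = reals s0 ''time'' l" if "l \<noteq> k" for l
          using inv that eq by (simp add: Inv_def)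
        let ?s3 = "set_real ''candidate'' 0 (cand r) s2"
        let ?s4 = "set_int ''found'' 0 1 (set_real ''time'' k (cand r) ?s3)"
        let ?lower = "r \<in> U \<and> (0 < ints s ''found'' 0 \<longrightarrow> cand r \<le> reals s ''time'' k)"
        have k: "ints s2 ''num_services'' 0 = k" "k \<le> ints s2 ''assigned'' r \<longleftrightarrow> r \<in> U"
          using pl2 r by (auto simp: planning_def)
        have Suc_r: "{i\<in>U. i < Suc r} = (if r \<in> U then insert r {i\<in>U. i < r} else {i\<in>U. i < r})"
          by (auto simp: less_Suc_eq)
        have found: "0 < ints s ''found'' 0 \<and> reals s ''time'' k = Min (cand ` {i\<in>U. i < r})"
          if "{i\<in>U. i < r} \<noteq> {}"
          using inv unfolding Inv_def if_not_P[OF that] by blast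
        have lower: "Inv (Suc r) (set_int ''i'' 0 (Suc r) ?s4)" if c: ?lower
        proof -
          have "Min (cand ` {i\<in>U. i < Suc r}) = cand r"
          proof (cases "{i\<in>U. i < r} = {}")
            case False
            have "cand r \<le> Min (cand ` {i\<in>U. i < r})"
              using found[OF False] c by simp
            then show ?thesis using False c fin by (simp add: Suc_r min_def)
          next
            case True
            have "{i\<in>U. i < Suc r} = {r}" unfolding Suc_r True using c by simp
            then show ?thesis by simp
          qed
          moreover have "{i\<in>U. i < Suc r} \<noteq> {}" using c by auto
          ultimately show ?thesis
            using same others unfolding Inv_def by (simp del: Collect_empty_eq)
        qed
        have keep: "Inv (Suc r) (set_int ''i'' 0 (Suc r) ?s3)" if c: "\<not> ?lower"
        proof -
          have c': "0 < ints s ''found'' 0 \<and> reals s ''time'' k < cand r" if "r \<in> U"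
            using c that by auto
          have "Min (cand ` {i\<in>U. i < Suc r}) = Min (cand ` {i\<in>U. i < r})" if "{i\<in>U. i < r} \<noteq> {}"
          proof (cases "r \<in> U")
            case True
            have "Min (insert (cand r) (cand ` {i\<in>U. i < r})) = min (cand r) (Min (cand ` {i\<in>U. i < r}))"
              using fin that by (intro Min_insert) auto
            also have "\<dots> = Min (cand ` {i\<in>U. i < r})"
              using found[OF that] c'[OF True] by (intro min_absorb2) linarith
            finally show ?thesis by (simp only: Suc_r True if_True image_insert)
          qed (simp add: Suc_r)
          moreover have "{i\<in>U. i < Suc r} = {} \<longleftrightarrow> {i\<in>U. i < r} = {}"
          proof (cases "r \<in> U")
            case True
            have "{i\<in>U. i < r} \<noteq> {}"
            proof
              assume "{i\<in>U. i < r} = {}"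
              from inv[unfolded Inv_def if_P[OF this]] c'[OF True] show False by linarith
            qed
            then show ?thesis by (simp only: Suc_r True if_True insert_not_empty)
          qed (simp add: Suc_r)
          ultimately show ?thesis
            using same eq others inv unfolding Inv_def by (simp del: Collect_empty_eq split: if_splits)
        qed
        have "halts_within lower_time (Suc (1 + 1))
            (\<lambda>s'. Inv (Suc r) (set_int ''i'' 0 (Suc (ints s' ''i'' 0)) s')) ?s3"
          unfolding lower_time_def
          by (intro halts_If halts_Seq halts_RSet halts_ISet halts_Skip) (use eq k lower keep in auto)
        then show "halts_within (Seq set_candidate lower_time) (1 + Suc (1 + 1))
            (\<lambda>s'. Inv (Suc r) (set_int ''i'' 0 (Suc (ints s' ''i'' 0)) s')) s2"
          by (intro halts_Seq cand)
      qed (use pl1 K in \<open>auto simp: planning_def inputs_loaded_def\<close>)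
    qed (use pls K in \<open>auto simp: planning_def inputs_loaded_def\<close>)
  next
    fix s assume inv: "Inv ?n s"
    have "{i\<in>U. i < ?n} = U" using U by auto
    with inv U(2) show "Q s"
      by (intro post) (auto simp: Inv_def trigger_time_def trigger_def cand_def)
  qed
  then show ?thesis by (rule halts_weaken) (simp_all add: algebra_simps)
qed

lemma halts_postpone:
  assumes pl: "planning J I k U s0" and U: "U \<subseteq> {..<length I}"
    and time: "reals s0 ''time'' k = trigger_time J I U"
    and post: "\<And>s. same_outside {''i'', ''j'', ''sum'', ''assigned'', ''more''} s0 s \<Longrightarrow>
      (0 < ints s ''more'' 0 \<longleftrightarrow> postponed J I U \<noteq> {}) \<Longrightarrow>
      (\<And>i. i < length I \<Longrightarrow> ints s ''assigned'' i =
        (if i \<in> postponed J I U then Suc k else ints s0 ''assigned'' i)) \<Longrightarrow> Q s"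
  shows "halts_within postpone (length I * (4 * length I + 8) + 3) Q s0"
proof -
  let ?n = "length I" and ?d = "\<lambda>i. deadline (I ! i)" and ?t = "trigger_time J I U"
  let ?X = "{''i'', ''j'', ''sum'', ''assigned'', ''more''}"
  let ?P = "postponed J I U"
  define Inv where "Inv r s \<longleftrightarrow> same_outside ?X s0 s \<and> ints s ''i'' 0 = r \<and>
    (0 < ints s ''more'' 0 \<longleftrightarrow> (\<exists>i<r. i \<in> ?P)) \<and>
    (\<forall>i<?n. ints s ''assigned'' i = (if i < r \<and> i \<in> ?P then Suc k else ints s0 ''assigned'' i))" for r s
  have PU: "?P \<subseteq> U" by (rule postponed_subset)
  have planning: "planning J I k U s" if "Inv r s" for r s
  proof -
    have "same_outside ?X s0 s" using that by (simp add: Inv_def)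
    then have "inputs_loaded J I s \<and> ints s ''num_services'' = ints s0 ''num_services''"
      by (rule inputs_same_outside[rotated]) (use pl in \<open>simp_all add: planning_def\<close>)
    moreover have "k \<le> ints s ''assigned'' i \<longleftrightarrow> i \<in> U" if "i < ?n" for i
      using \<open>Inv r s\<close> that pl PU by (auto simp: Inv_def planning_def)
    ultimately show ?thesis using pl by (simp add: planning_def)
  qed
  let ?body = "(4 * ?n + 3) + Suc (1 + 1)"
  have "halts_within postpone (1 + (?n * (?body + 2) + 2)) Q s0"
    unfolding postpone_def
  proof (rule halts_Seq, intro halts_ISet halts_for_loop[where Inv = Inv])
    show "Inv 0 (set_int ''i'' 0 0 (set_int ''more'' (ival (INum 0) s0) (ival (INum 0) s0) s0))"
      by (simp add: Inv_def)
  next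
    fix r s assume "Inv r s"
    with planning show "ints s ''i'' 0 = r \<and> ints s ''num_requests'' 0 = ?n"
      by (auto simp: Inv_def planning_def inputs_loaded_def)
  next
    fix r s assume r: "r < ?n" and inv: "Inv r s"
    note pls = planning[OF inv]
    have ir: "ints s ''i'' 0 = r" using inv by (simp add: Inv_def)
    have "reals s ''time'' = reals s0 ''time''" using inv by (simp add: Inv_def same_outside_def)
    then have time_s: "reals s ''time'' k = ?t" using time by simp
    show "halts_within (Seq (sum_loop ''sum'' held_expr (RTimes (RGet ''holding_rate'' (INum 0))
            (RMinus (at_index ''deadline'' ''j'') (at_index ''time'' ''num_services'')))) assign_next)
         ?body (\<lambda>s'. Inv (Suc r) (set_int ''i'' 0 (Suc (ints s' ''i'' 0)) s')) s"
    proof (rule halts_Seq, rule halts_sum_loop[where K = "held_upto I U ?t r"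
          and f = "\<lambda>i. holding_rate J * (?d i - ?t)"])
      fix s' assume s': "same_outside {''j'', ''sum''} s s'" "ints s' ''j'' 0 < ?n"
      have p: "planning J I k U s'" by (rule planning_same_outside[OF pls s'(1)]) simp_all
      have "ints s' ''i'' 0 = r" "reals s' ''time'' k = ?t"
        using s'(1) ir time_s by (simp_all add: same_outside_def)
      with p s'(2) r show "(bval held_expr s' \<longleftrightarrow> ints s' ''j'' 0 \<in> held_upto I U ?t r) \<and>
          rval (RTimes (RGet ''holding_rate'' (INum 0))
            (RMinus (at_index ''deadline'' ''j'') (at_index ''time'' ''num_services''))) s' =
          holding_rate J * (?d (ints s' ''j'' 0) - ?t)"
        by (auto simp: planning_def inputs_loaded_def held_upto_def held_expr_def not_less)
    next
      fix s1 assume s1: "same_outside {''j'', ''sum''} s s1"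
        and sum: "reals s1 ''sum'' 0 = (\<Sum>i\<in>held_upto I U ?t r. holding_rate J * (?d i - ?t))"
      have pl1: "planning J I k U s1" by (rule planning_same_outside[OF pls s1]) simp_all
      have eq: "ints s1 ''i'' 0 = r" "reals s1 ''time'' k = ?t" "ints s1 ''more'' = ints s ''more''"
          "ints s1 ''assigned'' = ints s ''assigned''"
        using s1 ir time_s by (simp_all add: same_outside_def)
      have inv_same: "same_outside ?X s0 s" using inv by (simp add: Inv_def)
      have same: "same_outside ?X s0 s1" by (rule same_outside_trans[OF inv_same s1]) simp
      have cond: "bval postpone_expr s1 \<longleftrightarrow> r \<in> ?P"
        using pl1 eq sum r
        by (auto simp: postpone_expr_def planning_def inputs_loaded_def postponed_def Let_def not_less)
      have k: "ints s1 ''num_services'' 0 = k" using pl1 by (simp add: planning_def)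
      show "halts_within assign_next (Suc (1 + 1))
          (\<lambda>s'. Inv (Suc r) (set_int ''i'' 0 (Suc (ints s' ''i'' 0)) s')) s1"
        unfolding assign_next_def
      proof (intro halts_If halts_Seq halts_ISet halts_Skip)
      qed (use cond k eq same inv in \<open>auto simp: Inv_def less_Suc_eq\<close>)
    qed (use pls U in \<open>auto simp: planning_def inputs_loaded_def held_upto_def\<close>)
  next
    fix s assume inv: "Inv ?n s"
    then show "Q s"
      using PU U by (intro post) (auto simp: Inv_def)
  qed
  then show ?thesis by (rule halts_weaken) (simp_all add: algebra_simps)
qed

text \<open>An entry of \<open>assigned\<close> below \<open>k\<close> is final and names the
  satisfying service; an entry equal to \<open>k\<close> marks a request that is still
  unserved.\<close>

definition planned :: "jrp \<Rightarrow> request list \<Rightarrow> nat \<Rightarrow> state \<Rightarrow> bool" where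
  "planned J I k s \<longleftrightarrow> inputs_loaded J I s \<and> ints s ''num_services'' 0 = k \<and>
     (0 < ints s ''more'' 0 \<longleftrightarrow> unserved J I k \<noteq> {}) \<and>
     (\<forall>i<length I. ints s ''assigned'' i \<le> k \<and> i \<in> unserved J I (ints s ''assigned'' i) \<and>
        (ints s ''assigned'' i < k \<longrightarrow> i \<notin> unserved J I (Suc (ints s ''assigned'' i)))) \<and>
     (\<forall>l<k. reals s ''time'' l = trigger_time J I (unserved J I l) \<and> ints s ''included'' l = 1)"

lemma planning_if_planned:
  assumes "planned J I k s"
  shows "planning J I k (unserved J I k) s"
proof -
  have "k \<le> ints s ''assigned'' i \<longleftrightarrow> i \<in> unserved J I k" if i: "i < length I" for i
  proof -
    let ?a = "ints s ''assigned'' i"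
    have a: "?a \<le> k" "i \<in> unserved J I ?a" "?a < k \<longrightarrow> i \<notin> unserved J I (Suc ?a)"
      using assms i unfolding planned_def by blast+
    show ?thesis
    proof (cases "?a < k")
      case True
      then show ?thesis using a(3) unserved_antimono[of "Suc ?a" k J I] by auto
    qed (use a in auto)
  qed
  then show ?thesis using assms by (simp add: planned_def planning_def)
qed

lemma halts_round:
  assumes pl: "planned J I k s0" and ne: "unserved J I k \<noteq> {}"
  shows "halts_within (Seq find_trigger (Seq postpone
         (Seq (ISet ''included'' (IGet ''num_services'' (INum 0)) (INum 1))
           (ISet ''num_services'' (INum 0) (IPlus (IGet ''num_services'' (INum 0)) (INum 1))))))
      (length I * (8 * length I + 12) + 3 + (length I * (4 * length I + 8) + 3 + (1 + 1)))
      (planned J I (Suc k)) s0"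
proof (rule halts_Seq, rule halts_find_trigger[OF planning_if_planned[OF pl] unserved_bounded ne])
  fix s1
  assume s1: "same_outside {''i'', ''j'', ''found'', ''sum'', ''count'', ''candidate'', ''time''} s0 s1"
    and t: "reals s1 ''time'' k = trigger_time J I (unserved J I k)"
    and others: "\<And>l. l \<noteq> k \<Longrightarrow> reals s1 ''time'' l = reals s0 ''time'' l"
  have pl1: "planning J I k (unserved J I k) s1"
    by (rule planning_same_outside[OF planning_if_planned[OF pl] s1]) simp_all
  show "halts_within (Seq postpone
         (Seq (ISet ''included'' (IGet ''num_services'' (INum 0)) (INum 1))
           (ISet ''num_services'' (INum 0) (IPlus (IGet ''num_services'' (INum 0)) (INum 1)))))
      (length I * (4 * length I + 8) + 3 + (1 + 1)) (planned J I (Suc k)) s1"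
  proof (rule halts_Seq, rule halts_postpone[OF pl1 unserved_bounded t])
    fix s2 assume s2: "same_outside {''i'', ''j'', ''sum'', ''assigned'', ''more''} s1 s2"
      and more: "0 < ints s2 ''more'' 0 \<longleftrightarrow> postponed J I (unserved J I k) \<noteq> {}"
      and assigned: "\<And>i. i < length I \<Longrightarrow> ints s2 ''assigned'' i =
        (if i \<in> postponed J I (unserved J I k) then Suc k else ints s1 ''assigned'' i)"
    have inputs: "inputs_loaded J I s2"
      using inputs_same_outside[OF _ s2] pl1 by (simp add: planning_def)
    have eq: "ints s2 ''num_services'' 0 = k" "reals s2 ''time'' = reals s1 ''time''"
        "ints s2 ''included'' = ints s0 ''included''" "ints s1 ''assigned'' = ints s0 ''assigned''"
      using s1 s2 pl by (simp_all add: same_outside_def planned_def)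
    let ?s3 = "set_int ''num_services'' 0 (Suc k) (set_int ''included'' k 1 s2)"
    \<comment> \<open>Only requests with entry \<open>k\<close> are in play: a postponed one moves
      to \<open>Suc k\<close>, and any other keeps \<open>k\<close>, which now is the number of the
      service that satisfies it.\<close>
    have levels: "ints s2 ''assigned'' i \<le> Suc k \<and> i \<in> unserved J I (ints s2 ''assigned'' i) \<and>
        (ints s2 ''assigned'' i < Suc k \<longrightarrow> i \<notin> unserved J I (Suc (ints s2 ''assigned'' i)))"
      if i: "i < length I" for i
    proof -
      have "ints s0 ''assigned'' i \<le> k" "i \<in> unserved J I (ints s0 ''assigned'' i)"
        "ints s0 ''assigned'' i < k \<longrightarrow> i \<notin> unserved J I (Suc (ints s0 ''assigned'' i))"
        using pl i unfolding planned_def by blast+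
      then show ?thesis
        using assigned[OF i] eq(4) by (cases "ints s0 ''assigned'' i = k") (auto simp: unserved_Suc)
    qed
    have "reals s2 ''time'' l = trigger_time J I (unserved J I l) \<and> (l < k \<longrightarrow> ints s2 ''included'' l = 1)"
      if "l \<le> k" for l
      using that pl t others[of l] eq by (cases "l = k") (auto simp: planned_def)
    then have "planned J I (Suc k) ?s3"
      using inputs more levels
      by (auto simp: planned_def inputs_loaded_def unserved_Suc less_Suc_eq_le)
    then show "halts_within (Seq (ISet ''included'' (IGet ''num_services'' (INum 0)) (INum 1))
           (ISet ''num_services'' (INum 0) (IPlus (IGet ''num_services'' (INum 0)) (INum 1))))
      (1 + 1) (planned J I (Suc k)) s2"
      by (intro halts_Seq halts_ISet) (simp add: eq)
  qed
qed

section \<open>Output of the program and the cubic bound\<close>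

lemma services_of_planned:
  assumes J: "J \<in> single_item" and pl: "planned J I (length (algorithm J I)) s"
  shows "services_of J I s = algorithm J I"
proof -
  let ?m = "length (algorithm J I)"
  have n: "num_items J = 1" using single_item_simps[OF J] by simp
  have "{i. i < length I \<and> ints s ''assigned'' i = k} = unserved J I k - unserved J I (Suc k)"
    if k: "k < ?m" for k
  proof (intro set_eqI)
    fix i
    let ?a = "ints s ''assigned'' i"
    have "i < length I \<and> ?a = k \<longleftrightarrow> i \<in> unserved J I k - unserved J I (Suc k)" if i: "i < length I"
    proof -
      have a: "i \<in> unserved J I ?a" "?a < ?m \<longrightarrow> i \<notin> unserved J I (Suc ?a)" "?a \<le> ?m"
        using pl i unfolding planned_def by blast+
      \<comment> \<open>Nothing is unserved after the last service, so no entry can still have the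
        pending value \<open>?m\<close>.\<close>
      have "?a < ?m" using a unserved_length[OF J, of I] by (cases "?a = ?m") auto
      then show ?thesis
        using a i unserved_antimono[of "Suc k" ?a J I] unserved_antimono[of "Suc ?a" k J I]
        by (cases ?a k rule: linorder_cases) auto
    qed
    then show "i \<in> {i. i < length I \<and> ints s ''assigned'' i = k} \<longleftrightarrow> i \<in> unserved J I k - unserved J I (Suc k)"
      using unserved_bounded[of J I k] by blast
  qed
  moreover have "{v. v < num_items J \<and> ints s ''included'' (k * num_items J + v) \<noteq> 0} = {0}"
    if "k < ?m" for k
    using pl that n by (auto simp: planned_def)
  moreover have "reals s ''time'' k = trigger_time J I (unserved J I k)" if "k < ?m" for k
    using pl that by (simp add: planned_def)
  moreover have "ints s ''num_services'' 0 = ?m" using pl by (simp add: planned_def)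
  ultimately show ?thesis
    unfolding services_of_def by (subst algorithm_eq_map[OF J]) (auto intro!: map_cong)
qed

lemma polynomial_time_algorithm: "polynomial_time single_item algorithm"
  unfolding polynomial_time_def
proof (intro exI[of _ algorithm_program] exI[of _ "monom 20 3"] ballI allI impI)
  fix J I assume J: "J \<in> single_item" and v: "valid_requests J I"
  let ?n = "length I" and ?m = "length (algorithm J I)" and ?s0 = "initial_state J I"
  let ?B = "?n * (8 * ?n + 12) + 3 + (?n * (4 * ?n + 8) + 3 + (1 + 1))"
  have init: "planned J I 0 (set_int ''more'' 0 ?n ?s0)"
    using single_item_simps(1)[OF J]
    by (auto simp: planned_def inputs_loaded_def initial_state_def order_cost_def lessThan_empty_iff)
  have "halts_within algorithm_program (1 + (?m * (?B + 1) + 1)) (planned J I ?m) ?s0"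
    unfolding algorithm_program_def
  proof (rule halts_Seq, rule halts_ISet, rule halts_While[where Inv = "planned J I"], rule conjI)
    fix k s assume k: "k < ?m" "planned J I k s"
    then have ne: "unserved J I k \<noteq> {}" using unserved_nonempty[OF J] by blast
    with k show "bval (ILess (INum 0) (IGet ''more'' (INum 0))) s" by (simp add: planned_def)
    show "halts_within (Seq find_trigger (Seq postpone
         (Seq (ISet ''included'' (IGet ''num_services'' (INum 0)) (INum 1))
           (ISet ''num_services'' (INum 0) (IPlus (IGet ''num_services'' (INum 0)) (INum 1))))))
         ?B (planned J I (Suc k)) s"
      using k ne by (intro halts_round)
  next
    fix s assume "planned J I ?m s"
    then show "\<not> bval (ILess (INum 0) (IGet ''more'' (INum 0))) s"
      using unserved_length[OF J] by (simp add: planned_def)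
  next
    show "planned J I 0 (set_int ''more'' (ival (INum 0) ?s0) (ival (IGet ''num_requests'' (INum 0)) ?s0) ?s0)"
      using init by (simp add: initial_state_def)
  qed
  then obtain t s where run: "run algorithm_program ?s0 t s" "t \<le> 1 + (?m * (?B + 1) + 1)"
    "planned J I ?m s" unfolding halts_within_def by blast
  have "1 + (?m * (?B + 1) + 1) \<le> 1 + (?n * (?B + 1) + 1)"
    using length_algorithm_le[OF J, of I] by (intro add_mono mult_right_mono) auto
  \<comment> \<open>\<open>?B\<close> expands to \<open>12 n^2 + 20 n + 8\<close>, and every round
    satisfies at least one request, so there are at most \<open>n\<close> rounds. The base
    \<open>1 + ?n\<close> is the input size with its single item.\<close>
  also have "\<dots> \<le> 20 * (1 + ?n) ^ 3" by (simp add: power3_eq_cube algebra_simps)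
  finally have "t \<le> poly (monom 20 3) (num_items J + ?n)"
    using run(2) single_item_simps(1)[OF J] by (simp add: poly_monom)
  then show "\<exists>t s. run algorithm_program ?s0 t s \<and> t \<le> poly (monom 20 3) (num_items J + ?n) \<and>
      algorithm J I = services_of J I s"
    using run services_of_planned[OF J run(3)] by metis
qed

theorem theorem1:
  shows "\<exists>A :: jrp \<Rightarrow> request list \<Rightarrow> service list.
    polynomial_time single_item A \<and>
    (\<forall>J\<in>single_item.
       online_algorithm J (A J) \<and>
       (backlog_rate J > 0 \<or> root_cost J + leaf_cost J 0 = 0 \<longrightarrow> competitive J 3 (A J)))"
  using polynomial_time_algorithm online_algorithm_algorithm competitive_algorithm
  unfolding order_cost_def by blast

end
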